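(* Let $1\le m\le n-1$ and let $E=E_m$, $M$, $F$ and the inclusions of bigraded rings $\mathcal{R}(E)\subset\mathcal{R}(M)\subset\mathcal{R}(F)$ be as in the context. Then: (a) $\mathcal{R}(E)_{\ge d_m-1,*}=\mathcal{R}(M)_{\ge d_m-1,*}=\mathcal{R}(F)_{\ge d_m-1,*}$. (b) $\mathcal{R}(M)$ is the integral closure of $\mathcal{R}(E)$ in its field of fractions. (c) $E$ is a reduction of $M$ in $F$.
   Context: Let $\Bbbk$ be a field, $R=\Bbbk[x_0,x_1]$ with the standard grading, $\mathfrak{m}=(x_0,x_1)$. For a finitely generated $R$-module $E$, the Rees algebra $\mathcal{R}(E)$ is the symmetric algebra of $E$ modulo its $R$-torsion. Let $I\subset R$ be a height two ideal minimally generated by $n$ forms $f_1,\dots,f_n$ of degree $d$, with graded free (Hilbert-Burch) resolution $0\to\bigoplus_{i=1}^{n-1}R(-d_i)\xrightarrow{\varphi}R^n\to I(d)\to0$, $1\le d_1\le\cdots\le d_{n-1}$. For $1\le m\le n-1$ let $\varphi_m$ be the matrix of the first $m$ columns of $\varphi$ and $E_m=\operatorname{coker}\varphi_m$. Fix $m$; set $s=n-m$, $E=E_m$ (a torsionfree module of rank $s$ generated in degree 0), $F=E^{**}$ where $-^*=\operatorname{Hom}_R(-,R)$. $F$ is graded free; fix $F\cong\bigoplus_{i=1}^sR(\sigma_i)$ with $\sigma_1\ge\cdots\ge\sigma_s\ge0$. Let $M=F_{\ge0}=\bigoplus_{i=1}^s\mathfrak{m}^{\sigma_i}(\sigma_i)$,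 so that $E\subset M\subset F$. $\mathcal{R}(F)=R[w_1,\dots,w_s]$ is a polynomial ring, $w_i$ corresponding to the $i$th basis element of $F$, bigraded by $\deg x_i=(1,0)$, $\deg w_i=(-\sigma_i,1)$, and $E\subset M\subset F$ induce inclusions of bigraded rings $\mathcal{R}(E)\subset\mathcal{R}(M)\subset\mathcal{R}(F)$ (the subalgebras generated over $R$ by $E$ and by $M$, in degree one). For a bigraded ring $A$, $A_{\ge i,*}=\bigoplus_{k\ge i}\bigoplus_jA_{k,j}$. "$E$ is a reduction of $M$ in $F$" means that every element of $M$, viewed in degree one of $\operatorname{Sym}(F)=\mathcal{R}(F)$, is integral over the $R$-subalgebra generated by $E$ (equivalently $M^{j+1}=EM^j$ in $\operatorname{Sym}(F)$ for some $j$). *)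

theory Defs
  imports
    "HOL-Algebra.Algebra"
    "HOL-Algebra.Algebraic_Closure_Type"
    "HOL-Computational_Algebra.Computational_Algebra"
    "HOL-Library.Poly_Mapping"
    "HOL-Library.Function_Algebras"
    "HOL-Library.Extended_Nat"
begin

section \<open>The ring \<open>R = k[x\<^sub>0, x\<^sub>1]\<close>\<close>

text \<open>The variables \<open>x\<^sub>0, x\<^sub>1\<close> are indexed by \<^const>\<open>False\<close> and \<^const>\<open>True\<close>; a key is an exponent
  vector. All other indices below are 0-based.\<close>

type_synonym 'k bpoly = "(bool \<Rightarrow>\<^sub>0 nat) \<Rightarrow>\<^sub>0 'k"

text \<open>Forms of a (possibly negative) degree; the zero polynomial is a form of every degree.\<close>

definition form :: "int \<Rightarrow> 'k::zero bpoly \<Rightarrow> bool" where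
  "form e p \<longleftrightarrow>
    (\<forall>t\<in>Poly_Mapping.keys p. int (\<Sum>x\<in>UNIV. Poly_Mapping.lookup t x) = e)"

section \<open>Ideals\<close>

definition prime_height :: "('a, 'b) ring_scheme \<Rightarrow> 'a set \<Rightarrow> enat" where
  "prime_height R P = Sup {enat l |l. \<exists>Q. (\<forall>i\<le>l. primeideal (Q i) R) \<and>
      (\<forall>i<l. Q i \<subset> Q (Suc i)) \<and> Q l = P}"

definition ideal_height :: "('a, 'b) ring_scheme \<Rightarrow> 'a set \<Rightarrow> enat" where
  "ideal_height R I = (INF P\<in>{P. primeideal P R \<and> I \<subseteq> P}. prime_height R P)"

definition minimally_generates ::
    "('a, 'b) ring_scheme \<Rightarrow> nat \<Rightarrow> (nat \<Rightarrow> 'a) \<Rightarrow> 'a set \<Rightarrow> bool" where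
  "minimally_generates R n f I \<longleftrightarrow>
    I = genideal R (f ` {..<n}) \<and> (\<forall>j<n. genideal R (f ` ({..<n} - {j})) \<noteq> I)"

section \<open>Graded modules\<close>

text \<open>Elements of the direct sum of the additive subgroups \<open>C i\<close>, \<open>i \<in> J\<close>, of a common group.\<close>

definition sum_of_pieces :: "'i set \<Rightarrow> ('i \<Rightarrow> 'a::comm_monoid_add set) \<Rightarrow> 'a set" where
  "sum_of_pieces J C = {\<Sum>i\<in>K. g i |K g. finite K \<and> K \<subseteq> J \<and> (\<forall>i\<in>K. g i \<in> C i)}"

text \<open>The scalars form a type, so that no ring record is needed for them. The ring fields \<open>mult\<close>
  and \<open>one\<close> inherited from the record \<^type>\<open>module\<close> play no role for modules and are left
  \<^const>\<open>undefined\<close>.\<close>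

record ('a, 'b) graded_module = "('a, 'b) module" +
  gr :: "int \<Rightarrow> 'b set"

text \<open>\<open>free_module s a = R(a\<^sub>0) \<oplus> \<dots> \<oplus> R(a\<^bsub>s-1\<^esub>)\<close>\<close>

definition free_module ::
    "nat \<Rightarrow> (nat \<Rightarrow> int) \<Rightarrow> ('k::comm_ring_1 bpoly, nat \<Rightarrow> 'k bpoly) graded_module" where
  "free_module s a = \<lparr>carrier = {v. \<forall>i\<ge>s. v i = 0},
     monoid.mult = undefined, monoid.one = undefined,
     ring.zero = 0, add = (+), module.smult = (\<lambda>r v i. r * v i),
     gr = (\<lambda>e. {v. (\<forall>i\<ge>s. v i = 0) \<and> (\<forall>i<s. form (e + a i) (v i))})\<rparr>"

definition base_module :: "('k::comm_ring_1 bpoly, 'k bpoly) graded_module" where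
  "base_module = \<lparr>carrier = UNIV,
     monoid.mult = undefined, monoid.one = undefined,
     ring.zero = 0, add = (+), module.smult = (*), gr = (\<lambda>e. {p. form e p})\<rparr>"

definition quotient_module ::
    "('a, 'b) graded_module \<Rightarrow> 'b set \<Rightarrow> ('a, 'b set) graded_module" where
  "quotient_module P U = \<lparr>carrier = a_rcosets\<^bsub>P\<^esub> U,
     monoid.mult = undefined, monoid.one = undefined,
     ring.zero = U, add = (\<lambda>C D. C <+>\<^bsub>P\<^esub> D),
     module.smult = (\<lambda>r C. \<Union>x\<in>C. U +>\<^bsub>P\<^esub> (r \<odot>\<^bsub>P\<^esub> x)),
     gr = (\<lambda>e. (\<lambda>x. U +>\<^bsub>P\<^esub> x) ` gr P e)\<rparr>"

definition linear_map ::
    "('a, 'b, 'x) module_scheme \<Rightarrow> ('a, 'c, 'y) module_scheme \<Rightarrow> ('b \<Rightarrow> 'c) \<Rightarrow> bool" where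
  "linear_map N P g \<longleftrightarrow> g \<in> carrier N \<rightarrow> carrier P \<and>
    (\<forall>x\<in>carrier N. \<forall>y\<in>carrier N. g (x \<oplus>\<^bsub>N\<^esub> y) = g x \<oplus>\<^bsub>P\<^esub> g y) \<and>
    (\<forall>r. \<forall>x\<in>carrier N. g (r \<odot>\<^bsub>N\<^esub> x) = r \<odot>\<^bsub>P\<^esub> g x)"

definition graded_iso ::
    "('a, 'b) graded_module \<Rightarrow> ('a, 'c) graded_module \<Rightarrow> ('b \<Rightarrow> 'c) \<Rightarrow> bool" where
  "graded_iso N P g \<longleftrightarrow>
    linear_map N P g \<and> bij_betw g (carrier N) (carrier P) \<and> (\<forall>e. g ` gr N e = gr P e)"

text \<open>\<open>dual N = Hom\<^sub>R(N, R)\<close>, where a map is homogeneous of degree \<open>a\<close> if it raises degrees by \<open>a\<close>.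
  Maps are normalized to be \<^const>\<open>undefined\<close> outside the carrier.\<close>

definition dual ::
    "('k::comm_ring_1 bpoly, 'b) graded_module \<Rightarrow> ('k bpoly, 'b \<Rightarrow> 'k bpoly) graded_module" where
  "dual N = \<lparr>carrier = {g \<in> extensional (carrier N). linear_map N base_module g},
     monoid.mult = undefined, monoid.one = undefined,
     ring.zero = (\<lambda>x\<in>carrier N. 0), add = (\<lambda>g h. \<lambda>x\<in>carrier N. g x + h x),
     module.smult = (\<lambda>r g. \<lambda>x\<in>carrier N. r * g x),
     gr = (\<lambda>a. {g \<in> extensional (carrier N). linear_map N base_module g \<and>
                 (\<forall>e. \<forall>x\<in>gr N e. form (e + a) (g x))})\<rparr>"

definition bidual_eval ::
    "('k::comm_ring_1 bpoly, 'b) graded_module \<Rightarrow> 'b \<Rightarrow> ('b \<Rightarrow> 'k bpoly) \<Rightarrow> 'k bpoly" where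
  "bidual_eval N x = (\<lambda>g\<in>carrier (dual N). g x)"

section \<open>The Hilbert-Burch resolution and the modules \<open>E\<^sub>m\<close>\<close>

text \<open>The matrix entry in row \<open>j\<close> and column \<open>i\<close> is \<open>\<phi> j i\<close>; only the rows \<open>j < n\<close> and the columns
  \<open>i < l\<close> are used.\<close>

definition mat_map ::
    "nat \<Rightarrow> nat \<Rightarrow> (nat \<Rightarrow> nat \<Rightarrow> 'r) \<Rightarrow> (nat \<Rightarrow> 'r::comm_ring_1) \<Rightarrow> nat \<Rightarrow> 'r" where
  "mat_map n l \<phi> a = (\<lambda>j. if j < n then \<Sum>i<l. \<phi> j i * a i else 0)"

text \<open>Graded exactness of \<open>0 \<rightarrow> \<Oplus>\<^sub>i R(-\<delta>\<^sub>i) \<rightarrow> R\<^sup>n \<rightarrow> I(d) \<rightarrow> 0\<close>, for \<open>I\<close> generated by forms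
  \<open>f\<^sub>0, \<dots>, f\<^bsub>n-1\<^esub>\<close> of equal degree \<open>d\<close>.\<close>

definition hilbert_burch_resolution ::
    "nat \<Rightarrow> (nat \<Rightarrow> 'k::comm_ring_1 bpoly) \<Rightarrow> (nat \<Rightarrow> nat) \<Rightarrow> (nat \<Rightarrow> nat \<Rightarrow> 'k bpoly) \<Rightarrow> bool" where
  "hilbert_burch_resolution n f \<delta> \<phi> \<longleftrightarrow>
    (let G = free_module (n - 1) (\<lambda>i. - int (\<delta> i)); H = free_module n (\<lambda>j. 0) in
      (\<forall>j<n. \<forall>i<n - 1. form (int (\<delta> i)) (\<phi> j i)) \<and>
      inj_on (mat_map n (n - 1) \<phi>) (carrier G) \<and>
      mat_map n (n - 1) \<phi> ` carrier G = {a \<in> carrier H. (\<Sum>j<n. a j * f j) = 0})"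

text \<open>The cokernel of the matrix formed by the first \<open>m\<close> columns of \<open>\<phi>\<close>, with generators in
  degree 0.\<close>

definition E_module ::
    "nat \<Rightarrow> nat \<Rightarrow> (nat \<Rightarrow> nat \<Rightarrow> 'k::comm_ring_1 bpoly)
      \<Rightarrow> ('k bpoly, (nat \<Rightarrow> 'k bpoly) set) graded_module" where
  "E_module n m \<phi> = quotient_module (free_module n (\<lambda>j. 0))
     (mat_map n m \<phi> ` carrier (free_module m (\<lambda>i. 0)))"

section \<open>Rees algebras\<close>

text \<open>The outer variables are \<open>w\<^sub>0, w\<^sub>1, \<dots>\<close>; the coefficients are in \<open>R\<close>.\<close>

type_synonym 'k wpoly = "(nat \<Rightarrow>\<^sub>0 nat) \<Rightarrow>\<^sub>0 'k bpoly"

text \<open>The element \<open>\<Sum>\<^sub>i v\<^sub>i w\<^sub>i\<close> of degree one of \<open>Sym(F)\<close>, for \<open>v \<in> F = R\<^sup>s\<close>.\<close>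

definition lin :: "nat \<Rightarrow> (nat \<Rightarrow> 'k::comm_ring_1 bpoly) \<Rightarrow> 'k wpoly" where
  "lin s v = (\<Sum>i<s. Poly_Mapping.single (Poly_Mapping.single i 1) (v i))"

text \<open>The Rees algebra of a submodule \<open>N\<close> of \<open>F = R\<^sup>s\<close>, as the \<open>R\<close>-subalgebra of \<open>Sym(F)\<close>
  generated by \<open>N\<close>.\<close>

inductive_set Rees :: "nat \<Rightarrow> (nat \<Rightarrow> 'k::comm_ring_1 bpoly) set \<Rightarrow> 'k wpoly set"
  for s :: nat and N :: "(nat \<Rightarrow> 'k bpoly) set" where
  Rees_const: "Poly_Mapping.single 0 r \<in> Rees s N"
| Rees_lin: "v \<in> N \<Longrightarrow> lin s v \<in> Rees s N"
| Rees_add: "p \<in> Rees s N \<Longrightarrow> q \<in> Rees s N \<Longrightarrow> p + q \<in> Rees s N"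
| Rees_mult: "p \<in> Rees s N \<Longrightarrow> q \<in> Rees s N \<Longrightarrow> p * q \<in> Rees s N"

text \<open>\<open>Sym(F) = \<R>(F) = R[w\<^sub>0, \<dots>, w\<^bsub>s-1\<^esub>]\<close>\<close>

definition Rees_free :: "nat \<Rightarrow> 'k::comm_ring_1 wpoly set" where
  "Rees_free s = {p. \<forall>t\<in>Poly_Mapping.keys p. Poly_Mapping.keys t \<subseteq> {..<s}}"

text \<open>The elements of bidegree \<open>(k, j)\<close>, where \<open>deg x\<^sub>i = (1, 0)\<close> and \<open>deg w\<^sub>i = (-\<sigma>\<^sub>i, 1)\<close>.\<close>

definition bipiece :: "(nat \<Rightarrow> nat) \<Rightarrow> int \<Rightarrow> nat \<Rightarrow> 'k::comm_ring_1 wpoly set" where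
  "bipiece \<sigma> k j = {p. \<forall>t\<in>Poly_Mapping.keys p.
     (\<Sum>i\<in>Poly_Mapping.keys t. Poly_Mapping.lookup t i) = j \<and>
     form (k + (\<Sum>i\<in>Poly_Mapping.keys t. int (\<sigma> i) * int (Poly_Mapping.lookup t i)))
       (Poly_Mapping.lookup p t)}"

text \<open>\<open>A\<^bsub>\<ge>i,*\<^esub>\<close>\<close>

definition bitruncation ::
    "(nat \<Rightarrow> nat) \<Rightarrow> int \<Rightarrow> 'k::comm_ring_1 wpoly set \<Rightarrow> 'k wpoly set" where
  "bitruncation \<sigma> i A = sum_of_pieces {(k, j). i \<le> k} (\<lambda>(k, j). A \<inter> bipiece \<sigma> k j)"

section \<open>Integral closure\<close>

definition integral_over :: "'a::comm_ring_1 set \<Rightarrow> 'a \<Rightarrow> bool" where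
  "integral_over A z \<longleftrightarrow>
    (\<exists>p. lead_coeff p = 1 \<and> (\<forall>i. Polynomial.coeff p i \<in> A) \<and> poly p z = 0)"

definition frac_field :: "'a::idom set \<Rightarrow> 'a fract set" where
  "frac_field A = {Fract a b |a b. a \<in> A \<and> b \<in> A \<and> b \<noteq> 0}"

definition integral_closure_in :: "'a::comm_ring_1 set \<Rightarrow> 'a set \<Rightarrow> 'a set" where
  "integral_closure_in A K = {z \<in> K. integral_over A z}"

text \<open>\<open>N\<close> is a reduction of \<open>M\<close> in \<open>F = R\<^sup>s\<close>; \<open>N\<close> and \<open>M\<close> are submodules of \<open>F\<close> with \<open>N \<subseteq> M\<close>.\<close>

definition is_reduction_in_free ::
    "nat \<Rightarrow> (nat \<Rightarrow> 'k::comm_ring_1 bpoly) set \<Rightarrow> (nat \<Rightarrow> 'k bpoly) set \<Rightarrow> bool" where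
  "is_reduction_in_free s N M \<longleftrightarrow> (\<forall>v\<in>M. integral_over (Rees s N) (lin s v))"

end

theory Submission
  imports Defs "Jordan_Normal_Form.Char_Poly"
begin

text \<open>
  Put \<open>K = d\<^sub>m - 1\<close>. All three claims rest on one fact about modules: the component of \<open>F\<close> in degree \<open>K\<close>
  is contained in \<open>E\<close>. Cohomologically, \<open>F/E\<close> has finite length, so it is the first local cohomology of
  \<open>E\<close>; this embeds in the second local cohomology of \<open>\<Oplus>\<^sub>i R(-d\<^sub>i)\<close> with \<open>i \<le> m\<close>, which vanishes in degrees at
  least \<open>K\<close>. The lemma \<open>high_degree_in_image\<close> carries this out with explicit Cech cochains: an element
  \<open>u\<close> of \<open>F\<close> of degree \<open>K\<close> lifts to \<open>R\<^sup>n\<close> after multiplication by a power of \<open>x\<^sub>0\<close>, and also by a power of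
  \<open>x\<^sub>1\<close>; the difference of the two lifts on the overlap is a relation whose coefficients have so high a
  degree that it can be absorbed in the lifts, which then glue.

  That \<open>F/E\<close> is killed by powers of both variables comes from the resolution. Up to a common factor,
  which is invisible to the syzygies, the forms \<open>f j\<close> generate the unit ideal after a variable is
  inverted, so \<open>\<phi>\<close> acquires a left inverse there (\<open>hilbert_burch_local_splitting\<close>). The projection
  complementary to the columns of \<open>\<phi>\<close> supplies enough functionals to compare \<open>E\<close> with its bidual
  (\<open>iota_kernel\<close>, \<open>iota_cokernel\<close>).

  The step from modules to Rees algebras uses that all \<open>\<sigma>\<^sub>i\<close> are nonnegative. A monomial of first degree
  at least \<open>K\<close> in \<open>\<R>(F)\<close> has a factor \<open>x\<^sup>\<beta> w\<^sub>i\<close> of first degree \<open>K\<close>, which is a combination of elements of \<open>E\<close>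
  of degree 0 with coefficients of degree \<open>K\<close>; these coefficients are passed on to the remaining
  factors, and so on. Hence everything of first degree at least \<open>K\<close> lies in the ideal \<open>J\<close> of \<open>\<R>(E)\<close>
  generated by the monomials of degree \<open>K\<close> in \<open>x\<^sub>0, x\<^sub>1\<close> (\<open>weighted_subset_mpower_span\<close>). This is (a).

  The algebra \<open>\<R>(M)\<close> is spanned by the monomials of nonnegative first degree, so it multiplies \<open>J\<close> into
  itself. By the determinant trick it is integral over \<open>\<R>(E)\<close>, which gives (c) and one half of (b). For
  the other half, \<open>\<R>(M)\<close> is integrally closed, being spanned by the monomials that satisfy some linear
  inequalities; the proof compares leading monomials of \<open>c p\<^sup>i\<close> and \<open>q\<^sup>i r\<close> for large \<open>i\<close>
  (\<open>weighted_completely_integrally_closed\<close>).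
\<close>

section \<open>Leading monomials\<close>

abbreviation (input) lookup :: "('a \<Rightarrow>\<^sub>0 'b::zero) \<Rightarrow> 'a \<Rightarrow> 'b" where "lookup \<equiv> Poly_Mapping.lookup"
abbreviation (input) keys :: "('a \<Rightarrow>\<^sub>0 'b::zero) \<Rightarrow> 'a set" where "keys \<equiv> Poly_Mapping.keys"
abbreviation (input) single :: "'a \<Rightarrow> 'b \<Rightarrow> 'a \<Rightarrow>\<^sub>0 'b::zero" where "single \<equiv> Poly_Mapping.single"

lemma single_sum_keys:
  fixes p :: "'m \<Rightarrow>\<^sub>0 'a::comm_monoid_add"
  shows "p = (\<Sum>t\<in>keys p. single t (lookup p t))"
  by (rule poly_mapping_eqI) (simp add: lookup_sum lookup_single when_def in_keys_iff)

lemma single_eq_0_iff: "single t x = 0 \<longleftrightarrow> x = 0"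
  by (metis lookup_single_eq lookup_zero single_zero)

lemma single_sum: "single t (sum g A) = (\<Sum>i\<in>A. single t (g i))"
  by (induction A rule: infinite_finite_induct) (simp_all add: single_add)

text \<open>The largest exponent of a product comes from exactly one pair of exponents of the factors, so
  leading terms multiply.\<close>

lemma lookup_mult_Max_keys:
  fixes p q :: "'m::{linorder, ordered_cancel_comm_monoid_add} \<Rightarrow>\<^sub>0 'a::idom"
  assumes "p \<noteq> 0" "q \<noteq> 0"
  defines "a \<equiv> Max (keys p)" and "b \<equiv> Max (keys q)"
  shows "lookup (p * q) (a + b) = lookup p a * lookup q b"
    and "Max (keys (p * q)) = a + b"
proof -
  define p' q' where "p' = p - single a (lookup p a)"
    and "q' = q - single b (lookup q b)"
  have a: "a \<in> keys p" and b: "b \<in> keys q"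
    using assms by (auto simp: a_def b_def)
  have p': "t < a" if "t \<in> keys p'" for t
  proof -
    have "t \<noteq> a" "t \<in> keys p"
      using that by (auto simp: p'_def in_keys_iff lookup_minus lookup_single when_def split: if_splits)
    thus ?thesis by (auto simp: a_def order_le_neq_trans)
  qed
  have q': "t < b" if "t \<in> keys q'" for t
  proof -
    have "t \<noteq> b" "t \<in> keys q"
      using that by (auto simp: q'_def in_keys_iff lookup_minus lookup_single when_def split: if_splits)
    thus ?thesis by (auto simp: b_def order_le_neq_trans)
  qed
  have q: "t \<le> b" if "t \<in> keys q" for t
    using that by (auto simp: b_def)
  define r where "r = single a (lookup p a) * q' + p' * q"
  have eq: "p * q = single (a + b) (lookup p a * lookup q b) + r"
    by (simp add: r_def p'_def q'_def mult_single algebra_simps)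
  have r: "t < a + b" if "t \<in> keys r" for t
  proof -
    have "t \<in> keys (single a (lookup p a) * q') \<union> keys (p' * q)"
      using that keys_add[of "single a (lookup p a) * q'" "p' * q"] unfolding r_def by blast
    thus ?thesis
    proof
      assume "t \<in> keys (single a (lookup p a) * q')"
      with keys_mult[of "single a (lookup p a)" q'] obtain u v
        where "u \<in> keys (single a (lookup p a))" and v: "v \<in> keys q'" "t = u + v" by blast
      moreover from this have "u = a" by (simp split: if_splits)
      ultimately show ?thesis using q'[of v] by (simp add: add_strict_left_mono)
    next
      assume "t \<in> keys (p' * q)"
      with keys_mult[of p' q] obtain u v where "u \<in> keys p'" "v \<in> keys q" "t = u + v" by blast
      thus ?thesis using p'[of u] q[of v] by (simp add: add_less_le_mono)
    qed
  qed
  have "lookup r (a + b) = 0" using r by (metis in_keys_iff less_irrefl)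
  thus *: "lookup (p * q) (a + b) = lookup p a * lookup q b"
    by (simp add: eq lookup_add)
  show "Max (keys (p * q)) = a + b"
  proof (rule Max_eqI)
    show "a + b \<in> keys (p * q)"
      using * a b by (simp add: in_keys_iff)
    show "t \<le> a + b" if "t \<in> keys (p * q)" for t
    proof -
      have "t \<in> keys (single (a + b) (lookup p a * lookup q b)) \<union> keys r"
        using that keys_add[of "single (a + b) (lookup p a * lookup q b)" r] unfolding eq by blast
      thus ?thesis using r[of t] by (auto simp: less_imp_le split: if_splits)
    qed
  qed simp
qed

text \<open>Listing the exponents at the variables of \<open>S\<close> turns the order into the lexicographic order on
  lists of a fixed length. Finiteness of \<open>S\<close> matters: for variables indexed by the natural numbers,
  \<open>x\<^sub>0 > x\<^sub>1 > x\<^sub>2 > \<dots>\<close> is an infinite descent.\<close>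

lemma wf_monomial_order:
  fixes S :: "'v::linorder set"
  assumes "finite S"
  shows "wf {(t, t'). t < t' \<and> keys t \<subseteq> S \<and> keys (t' :: 'v \<Rightarrow>\<^sub>0 nat) \<subseteq> S}"
proof (rule wf_subset)
  define xs where "xs = sorted_list_of_set S"
  show "wf (inv_image (lex less_than) (\<lambda>t. map (lookup t :: 'v \<Rightarrow> nat) xs))"
    by (intro wf_inv_image wf_lex) simp
  show "{(t, t'). t < t' \<and> keys t \<subseteq> S \<and> keys t' \<subseteq> S}
      \<subseteq> inv_image (lex less_than) (\<lambda>t. map (lookup t :: 'v \<Rightarrow> nat) xs)"
  proof clarify
    fix t t' :: "'v \<Rightarrow>\<^sub>0 nat"
    assume "t < t'" and t': "keys t' \<subseteq> S"
    then obtain k where k: "lookup t k < lookup t' k" "\<And>l. l < k \<Longrightarrow> lookup t l = lookup t' l"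
      by (auto simp: less_poly_mapping.rep_eq less_fun_def)
    hence "k \<in> S" using t' by (auto simp: in_keys_iff)
    then obtain ys zs where xs: "xs = ys @ k # zs"
      using assms by (metis split_list set_sorted_list_of_set xs_def)
    have "l < k" if "l \<in> set ys" for l
    proof -
      have "sorted xs" "distinct xs" by (simp_all add: xs_def)
      hence "l \<le> k" "l \<noteq> k" using that unfolding xs by (auto simp: sorted_append)
      thus ?thesis by simp
    qed
    hence "map (lookup t) ys = map (lookup t') ys" using k by auto
    thus "(t, t') \<in> inv_image (lex less_than) (\<lambda>t. map (lookup t) xs)"
      using k(1) by (simp add: xs lex_append_leftI del: map_eq_conv)
  qed
qed

section \<open>Weights of monomials\<close>

definition xdeg :: "(bool \<Rightarrow>\<^sub>0 nat) \<Rightarrow> nat" where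
  "xdeg \<tau> = (\<Sum>x\<in>UNIV. lookup \<tau> x)"

definition wdeg :: "(nat \<Rightarrow> nat) \<Rightarrow> (nat \<Rightarrow>\<^sub>0 nat) \<Rightarrow> nat" where
  "wdeg \<sigma> t = (\<Sum>i\<in>keys t. \<sigma> i * lookup t i)"

lemma xdeg_0 [simp]: "xdeg 0 = 0" by (simp add: xdeg_def)
lemma xdeg_add [simp]: "xdeg (a + b) = xdeg a + xdeg b" by (simp add: xdeg_def lookup_add sum.distrib)
lemma xdeg_single [simp]: "xdeg (single b e) = e"
  by (cases b) (simp_all add: xdeg_def UNIV_bool lookup_single)

lemma wdeg_superset:
  "finite S \<Longrightarrow> keys t \<subseteq> S \<Longrightarrow> wdeg \<sigma> t = (\<Sum>i\<in>S. \<sigma> i * lookup t i)"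
  unfolding wdeg_def by (rule sum.mono_neutral_left) (auto simp: in_keys_iff)

lemma wdeg_0 [simp]: "wdeg \<sigma> 0 = 0" by (simp add: wdeg_def)
lemma wdeg_single [simp]: "wdeg \<sigma> (single i e) = \<sigma> i * e"
  by (simp add: wdeg_def)
lemma wdeg_add [simp]: "wdeg \<sigma> (a + b) = wdeg \<sigma> a + wdeg \<sigma> b"
proof -
  let ?S = "keys a \<union> keys b"
  show ?thesis using keys_add[of a b]
    by (simp add: wdeg_superset[of ?S] lookup_add algebra_simps sum.distrib)
qed

text \<open>The weight \<open>xdeg \<tau> - wdeg \<sigma> t\<close> of the monomial \<open>x\<^sup>\<tau> w\<^sup>t\<close> is its first degree in the bigrading. The
  monomials in \<open>w\<^sub>0, \<dots>, w\<^bsub>s-1\<^esub>\<close> of weight at least \<open>k\<close> span \<open>weighted \<sigma> s k\<close>; for \<open>k = 0\<close> this will be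
  the Rees algebra of \<open>M\<close>.\<close>

definition weighted :: "(nat \<Rightarrow> nat) \<Rightarrow> nat \<Rightarrow> nat \<Rightarrow> 'k::comm_ring_1 wpoly set" where
  "weighted \<sigma> s k = {p. \<forall>t\<in>keys p. keys t \<subseteq> {..<s} \<and>
     (\<forall>\<tau>\<in>keys (lookup p t). k + wdeg \<sigma> t \<le> xdeg \<tau>)}"

abbreviation (input) mono_xw :: "'k::comm_ring_1 \<Rightarrow> (bool \<Rightarrow>\<^sub>0 nat) \<Rightarrow> (nat \<Rightarrow>\<^sub>0 nat) \<Rightarrow> 'k wpoly" where
  "mono_xw c \<tau> t \<equiv> single t (single \<tau> c)"

lemma mono_xw_in_weighted:
  "keys t \<subseteq> {..<s} \<Longrightarrow> k + wdeg \<sigma> t \<le> xdeg \<tau> \<Longrightarrow> mono_xw c \<tau> t \<in> weighted \<sigma> s k"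
  by (auto simp: weighted_def lookup_single split: if_splits)

lemma weighted_0 [simp]: "0 \<in> weighted \<sigma> s k" by (simp add: weighted_def)

lemma weighted_add [intro]:
  assumes "p \<in> weighted \<sigma> s k" "q \<in> weighted \<sigma> s k" shows "p + q \<in> weighted \<sigma> s k"
  unfolding weighted_def
proof (clarify, rule conjI, goal_cases)
  case (1 t)
  hence "t \<in> keys p \<or> t \<in> keys q" using keys_add[of p q] by blast
  thus ?case using assms by (auto simp: weighted_def)
next
  case (2 t)
  show ?case
  proof
    fix \<tau> assume "\<tau> \<in> keys (lookup (p + q) t)"
    hence "\<tau> \<in> keys (lookup p t) \<or> \<tau> \<in> keys (lookup q t)"
      using keys_add[of "lookup p t" "lookup q t"] by (auto simp: lookup_add)
    thus "k + wdeg \<sigma> t \<le> xdeg \<tau>"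
    proof
      assume *: "\<tau> \<in> keys (lookup p t)"
      hence "t \<in> keys p" by (auto simp: in_keys_iff)
      thus ?thesis using * assms by (simp add: weighted_def)
    next
      assume *: "\<tau> \<in> keys (lookup q t)"
      hence "t \<in> keys q" by (auto simp: in_keys_iff)
      thus ?thesis using * assms by (simp add: weighted_def)
    qed
  qed
qed

lemma weighted_induct [consumes 1, case_names zero add mono]:
  assumes p: "p \<in> weighted \<sigma> s k"
    and zero: "P 0" and add: "\<And>a b. P a \<Longrightarrow> P b \<Longrightarrow> P (a + b)"
    and mono: "\<And>c \<tau> t. keys t \<subseteq> {..<s} \<Longrightarrow> k + wdeg \<sigma> t \<le> xdeg \<tau> \<Longrightarrow> P (mono_xw c \<tau> t)"
  shows "P p"
proof -
  have sum: "P (sum g A)" if "\<And>i. i \<in> A \<Longrightarrow> P (g i)" for g :: "'i \<Rightarrow> _" and A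
    using that by (induction A rule: infinite_finite_induct) (auto intro: zero add)
  have *: "P (single t (lookup p t))" if t: "t \<in> keys p" for t
  proof -
    have "single t (lookup p t) =
        (\<Sum>\<tau>\<in>keys (lookup p t). mono_xw (lookup (lookup p t) \<tau>) \<tau> t)"
      using arg_cong[OF single_sum_keys[of "lookup p t"], of "single t"] by (simp add: single_sum)
    moreover have "P (\<Sum>\<tau>\<in>keys (lookup p t). mono_xw (lookup (lookup p t) \<tau>) \<tau> t)"
      using p t by (intro sum mono) (auto simp: weighted_def)
    ultimately show ?thesis by simp
  qed
  show ?thesis by (subst single_sum_keys[of p]) (intro sum *)
qed

lemma weighted_mult [intro]:
  assumes "p \<in> weighted \<sigma> s k" "q \<in> weighted \<sigma> s l" shows "p * q \<in> weighted \<sigma> s (k + l)"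
  using assms(1)
proof (induction rule: weighted_induct)
  case (mono c \<tau> t)
  show ?case using assms(2)
  proof (induction rule: weighted_induct)
    case (mono d \<upsilon> u)
    have "keys (t + u) \<subseteq> {..<s}"
      using mono \<open>keys t \<subseteq> {..<s}\<close> keys_add[of t u] by blast
    thus ?case using mono \<open>k + wdeg \<sigma> t \<le> xdeg \<tau>\<close>
      by (auto simp: mult_single intro!: mono_xw_in_weighted)
  qed (auto simp: distrib_left)
qed (auto simp: distrib_right)

lemma weighted_const: "k = 0 \<Longrightarrow> single 0 r \<in> weighted \<sigma> s k"
  by (auto simp: weighted_def split: if_splits)

lemma weighted_uminus [intro]:
  assumes "p \<in> weighted \<sigma> s k" shows "- p \<in> weighted \<sigma> s k"
proof -
  have "single 0 (-1) * p \<in> weighted \<sigma> s (0 + k)"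
    by (rule weighted_mult[OF weighted_const assms]) simp
  thus ?thesis by (simp add: single_uminus)
qed

lemma weighted_diff [intro]:
  "p \<in> weighted \<sigma> s k \<Longrightarrow> q \<in> weighted \<sigma> s k \<Longrightarrow> p - q \<in> weighted \<sigma> s k"
  unfolding diff_conv_add_uminus by (intro weighted_add weighted_uminus)

section \<open>Complete integral closedness\<close>

text \<open>Comparison of slopes; \<open>i = c + 1\<close> already forces the claim.\<close>

lemma nat_slope_le:
  fixes a b c :: nat
  assumes "\<And>i. i * a \<le> c + i * b"
  shows "a \<le> b"
proof (rule ccontr)
  assume "\<not> a \<le> b"
  hence "Suc c * Suc b \<le> Suc c * a" by (intro mult_le_mono2) simp
  with assms[of "Suc c"] show False by simp
qed

lemma weighted_Max_keys:
  assumes "p \<in> weighted \<sigma> s k" "p \<noteq> 0"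
  defines "t \<equiv> Max (keys p)"
  defines "\<tau> \<equiv> Max (keys (lookup p t))"
  shows "t \<in> keys p" "\<tau> \<in> keys (lookup p t)" "keys t \<subseteq> {..<s}" "k + wdeg \<sigma> t \<le> xdeg \<tau>"
proof -
  show t: "t \<in> keys p" using assms by (auto simp: t_def)
  hence "lookup p t \<noteq> 0" by (simp add: in_keys_iff)
  thus "\<tau> \<in> keys (lookup p t)" by (auto simp: \<tau>_def)
  with t assms show "keys t \<subseteq> {..<s}" "k + wdeg \<sigma> t \<le> xdeg \<tau>" by (auto simp: weighted_def)
qed

text \<open>Leading exponents are additive, so \<open>c p\<^sup>i = q\<^sup>i r\<close> bounds \<open>i\<close> times the leading exponent of \<open>q\<close> by \<open>i\<close>
  times that of \<open>p\<close> plus a constant. As \<open>i\<close> grows, the leading monomial of \<open>q\<close> is seen to divide that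
  of \<open>p\<close>, and comparing weights in the same way, the quotient monomial has weight at least 0. Hence
  \<open>p - q \<mu>\<close> has a smaller leading monomial than \<open>p\<close> for some term \<open>\<mu>\<close> of the ring; it inherits the
  hypothesis, and well-founded induction finishes the division of \<open>p\<close> by \<open>q\<close>.

  This replaces the usual proof of normality through unique factorization.\<close>

lemma weighted_completely_integrally_closed:
  fixes p q c :: "'k::field wpoly"
  assumes pq: "p \<in> weighted \<sigma> s 0" "q \<in> weighted \<sigma> s 0" and nz: "q \<noteq> 0" "c \<noteq> 0"
    and all: "\<And>i. \<exists>r\<in>weighted \<sigma> s 0. c * p ^ i = q ^ i * r"
  shows "\<exists>g\<in>weighted \<sigma> s 0. p = q * g"
proof -
  \<comment> \<open>Exponent in \<open>w\<close>, exponent in \<open>x\<close>, and scalar of the leading term.\<close>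
  define lt :: "'k wpoly \<Rightarrow> _" where "lt p = Max (keys p)" for p
  define lx where "lx p = Max (keys (lookup p (lt p)))" for p :: "'k wpoly"
  define lcf where "lcf p = lookup (lookup p (lt p)) (lx p)" for p :: "'k wpoly"
  have lt_max: "t \<le> lt a" if "t \<in> keys a" for t a
    using that by (simp add: lt_def)
  have lx_max: "\<tau> \<le> lx a" if "\<tau> \<in> keys (lookup a (lt a))" for \<tau> a
    using that by (simp add: lx_def)
  have lt_nz: "lookup a (lt a) \<noteq> 0" "lcf a \<noteq> 0" if "a \<noteq> 0" for a
  proof -
    have max: "lookup b (Max (keys b)) \<noteq> 0" if "b \<noteq> 0" for b :: "'m::linorder \<Rightarrow>\<^sub>0 'b::zero"
      using Max_in[of "keys b"] that by (metis finite_keys in_keys_iff poly_mapping_eqI lookup_zero empty_iff)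
    from that show "lookup a (lt a) \<noteq> 0" unfolding lt_def by (rule max)
    from max[OF this] show "lcf a \<noteq> 0" by (simp add: lcf_def lx_def)
  qed
  have lt_mult: "lt (a * b) = lt a + lt b" and lx_mult: "lx (a * b) = lx a + lx b"
    and lcf_mult: "lcf (a * b) = lcf a * lcf b" if "a \<noteq> 0" "b \<noteq> 0" for a b
  proof -
    have 2: "lookup (a * b) (lt a + lt b) = lookup a (lt a) * lookup b (lt b)"
      using lookup_mult_Max_keys[OF that] by (simp add: lt_def)
    show 1: "lt (a * b) = lt a + lt b"
      using lookup_mult_Max_keys[OF that] by (simp add: lt_def)
    note * = lookup_mult_Max_keys[OF lt_nz(1)[OF that(1)] lt_nz(1)[OF that(2)]]
    show "lx (a * b) = lx a + lx b" "lcf (a * b) = lcf a * lcf b"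
      using * by (simp_all add: lx_def lcf_def 1 2)
  qed
  have power: "lookup (lt (a ^ i)) x = i * lookup (lt a) x \<and> lookup (lx (a ^ i)) y = i * lookup (lx a) y \<and>
      wdeg \<sigma> (lt (a ^ i)) = i * wdeg \<sigma> (lt a) \<and> xdeg (lx (a ^ i)) = i * xdeg (lx a)"
    if "a \<noteq> 0" for a i x y
  proof (induction i)
    case 0
    show ?case by (simp add: lt_def lx_def)
  next
    case (Suc i)
    thus ?case using that by (simp add: lt_mult lx_mult lookup_add)
  qed
  define less_t where "less_t = {(t, t'). t < t' \<and> keys t \<subseteq> {..<s} \<and> keys (t' :: nat \<Rightarrow>\<^sub>0 nat) \<subseteq> {..<s}}"
  define less_x where "less_x = {(\<tau>, \<tau>'). \<tau> < \<tau>' \<and> keys \<tau> \<subseteq> UNIV \<and> keys (\<tau>' :: bool \<Rightarrow>\<^sub>0 nat) \<subseteq> UNIV}"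
  have "wf (inv_image (less_t <*lex*> less_x) (\<lambda>p. (lt p, lx p)))"
    unfolding less_t_def less_x_def by (intro wf_inv_image wf_lex_prod wf_monomial_order) auto
  thus ?thesis using pq(1) all
  proof (induction p rule: wf_induct_rule)
    case (less p)
    show ?case
    proof (cases "p = 0")
      case True
      thus ?thesis by (intro bexI[of _ 0]) auto
    next
      case False
      have rel: "lookup (lt c) x + i * lookup (lt p) x = i * lookup (lt q) x + lookup (lt r) x"
        "lookup (lx c) y + i * lookup (lx p) y = i * lookup (lx q) y + lookup (lx r) y"
        "wdeg \<sigma> (lt c) + i * wdeg \<sigma> (lt p) = i * wdeg \<sigma> (lt q) + wdeg \<sigma> (lt r)"
        "xdeg (lx c) + i * xdeg (lx p) = i * xdeg (lx q) + xdeg (lx r)"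
        if "c * p ^ i = q ^ i * r" for i r x y
      proof -
        have r: "r \<noteq> 0" using that False nz by auto
        have "lt c + lt (p ^ i) = lt (q ^ i) + lt r" "lx c + lx (p ^ i) = lx (q ^ i) + lx r"
          using False nz r arg_cong[OF that, of lt] arg_cong[OF that, of lx]
          by (simp_all add: lt_mult lx_mult)
        from arg_cong[OF this(1), of "\<lambda>t. lookup t x"] arg_cong[OF this(2), of "\<lambda>t. lookup t y"]
          arg_cong[OF this(1), of "wdeg \<sigma>"] arg_cong[OF this(2), of xdeg]
        show "lookup (lt c) x + i * lookup (lt p) x = i * lookup (lt q) x + lookup (lt r) x"
          "lookup (lx c) y + i * lookup (lx p) y = i * lookup (lx q) y + lookup (lx r) y"
          "wdeg \<sigma> (lt c) + i * wdeg \<sigma> (lt p) = i * wdeg \<sigma> (lt q) + wdeg \<sigma> (lt r)"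
          "xdeg (lx c) + i * xdeg (lx p) = i * xdeg (lx q) + xdeg (lx r)"
          using False nz by (simp_all add: lookup_add power)
      qed
      have le_t: "lookup (lt q) x \<le> lookup (lt p) x" for x
      proof (rule nat_slope_le)
        fix i
        show "i * lookup (lt q) x \<le> lookup (lt c) x + i * lookup (lt p) x"
          using less.prems(2)[of i] rel(1)[of i _ x] by fastforce
      qed
      have le_x: "lookup (lx q) x \<le> lookup (lx p) x" for x
      proof (rule nat_slope_le)
        fix i
        show "i * lookup (lx q) x \<le> lookup (lx c) x + i * lookup (lx p) x"
          using less.prems(2)[of i] rel(2)[of i _ x] by fastforce
      qed
      define u v where "u = lt p - lt q" and "v = lx p - lx q"
      have u: "lt p = lt q + u" and v: "lx p = lx q + v"
        using le_t le_x by (auto intro!: poly_mapping_eqI simp: u_def v_def lookup_add lookup_minus)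
      have lead_p: "lt p \<in> keys p" "lx p \<in> keys (lookup p (lt p))" "keys (lt p) \<subseteq> {..<s}"
        using weighted_Max_keys[OF less.prems(1) False] by (simp_all add: lt_def lx_def)
      have "keys u \<subseteq> {..<s}"
      proof -
        have "keys u \<subseteq> keys (lt p)" by (auto simp: u lookup_add in_keys_iff)
        thus ?thesis using lead_p by blast
      qed
      moreover have "wdeg \<sigma> u \<le> xdeg v"
      proof (rule nat_slope_le)
        fix i
        obtain r where r: "r \<in> weighted \<sigma> s 0" "c * p ^ i = q ^ i * r" using less.prems(2) by blast
        hence r0: "r \<noteq> 0" using False nz by auto
        have "wdeg \<sigma> (lt r) \<le> xdeg (lx r)"
          using weighted_Max_keys(4)[OF r(1) r0] by (simp add: lt_def lx_def)
        thus "i * wdeg \<sigma> u \<le> xdeg (lx c) + i * xdeg v"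
          using rel(3,4)[OF r(2)] by (simp add: u v algebra_simps)
      qed
      ultimately have \<mu>: "mono_xw (lcf p / lcf q) v u \<in> weighted \<sigma> s 0" (is "?\<mu> \<in> _")
        by (intro mono_xw_in_weighted) auto
      define p' where "p' = p - q * ?\<mu>"
      have \<mu>_nz: "?\<mu> \<noteq> 0"
        using lt_nz(2)[OF False] lt_nz(2)[OF nz(1)] by (simp add: single_eq_0_iff)
      have lead_\<mu>: "lt ?\<mu> = u" "lx ?\<mu> = v" "lcf ?\<mu> = lcf p / lcf q"
        using lt_nz(2)[OF False] lt_nz(2)[OF nz(1)] by (simp_all add: lt_def[of ?\<mu>] lx_def[of ?\<mu>] lcf_def[of ?\<mu>] single_eq_0_iff)
      have lead_q\<mu>: "lt (q * ?\<mu>) = lt p" "lx (q * ?\<mu>) = lx p" "lcf (q * ?\<mu>) = lcf p"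
        using nz(1) \<mu>_nz lt_nz(2)[OF nz(1)] by (simp_all add: lt_mult lx_mult lcf_mult lead_\<mu> u v)
      have p': "p' \<in> weighted \<sigma> s 0"
        unfolding p'_def using less.prems(1) weighted_mult[OF pq(2) \<mu>] by auto
      have "\<exists>g\<in>weighted \<sigma> s 0. p' = q * g"
      proof (cases "p' = 0")
        case True
        thus ?thesis by (intro bexI[of _ 0]) auto
      next
        case nz': False
        have lead_p': "lt p' \<in> keys p'" "lx p' \<in> keys (lookup p' (lt p'))" "keys (lt p') \<subseteq> {..<s}"
        using weighted_Max_keys[OF p' nz'] by (simp_all add: lt_def lx_def)
        have le: "t \<le> lt p" if "t \<in> keys p'" for t
        proof -
          have "t \<in> keys p \<or> t \<in> keys (q * ?\<mu>)"
            using that by (auto simp: p'_def in_keys_iff lookup_minus)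
          thus ?thesis using lt_max[of t p] lt_max[of t "q * ?\<mu>"] lead_q\<mu>(1) by auto
        qed
        have "(lt p', lx p') \<noteq> (lt p, lx p)" "lt p' = lt p \<Longrightarrow> lx p' \<le> lx p"
        proof -
          have *: "lookup p' (lt p) = lookup p (lt p) - lookup (q * ?\<mu>) (lt p)"
            by (simp add: p'_def lookup_minus)
          hence "lookup (lookup p' (lt p)) (lx p) = 0"
            using lead_q\<mu> by (simp add: lookup_minus lcf_def)
          thus "(lt p', lx p') \<noteq> (lt p, lx p)" using lead_p'(2) by (metis in_keys_iff prod.inject)
          assume "lt p' = lt p"
          hence "lx p' \<in> keys (lookup p (lt p)) \<or> lx p' \<in> keys (lookup (q * ?\<mu>) (lt p))"
            using lead_p'(2) keys_diff[of "lookup p (lt p)" "lookup (q * ?\<mu>) (lt p)"] unfolding * by (auto simp: *)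
          thus "lx p' \<le> lx p"
            using lx_max[of "lx p'" p] lx_max[of "lx p'" "q * ?\<mu>"] lead_q\<mu>(1,2) by auto
        qed
        hence "(p', p) \<in> inv_image (less_t <*lex*> less_x) (\<lambda>p. (lt p, lx p))"
          using le[OF lead_p'(1)] lead_p(3) lead_p'(3) by (auto simp: less_t_def less_x_def)
        \<comment> \<open>Mixed powers of \<open>p\<close> and \<open>p'\<close> make a binomial expansion of \<open>(p - q \<mu>)\<^sup>i\<close> unnecessary.\<close>
        moreover have "\<exists>r\<in>weighted \<sigma> s 0. c * p ^ l * p' ^ i = q ^ (l + i) * r" for i l
        proof (induction i arbitrary: l)
          case 0
          thus ?case using less.prems(2) by simp
        next
          case (Suc i)
          obtain r1 r2 where r: "r1 \<in> weighted \<sigma> s 0" "r2 \<in> weighted \<sigma> s 0"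
            "c * p ^ Suc l * p' ^ i = q ^ (Suc l + i) * r1" "c * p ^ l * p' ^ i = q ^ (l + i) * r2"
            using Suc.IH[of "Suc l"] Suc.IH[of l] by blast
          have "c * p ^ l * p' ^ Suc i = c * p ^ Suc l * p' ^ i - c * p ^ l * p' ^ i * (q * ?\<mu>)"
            by (simp add: p'_def algebra_simps)
          also have "\<dots> = q ^ (l + Suc i) * (r1 - r2 * ?\<mu>)"
            unfolding r by (simp add: algebra_simps)
          finally show ?case
            using weighted_diff[OF r(1), of "r2 * ?\<mu>"] weighted_mult[OF r(2) \<mu>] by auto
        qed
        from this[of 0] have "\<exists>r\<in>weighted \<sigma> s 0. c * p' ^ i = q ^ i * r" for i by simp
        ultimately show ?thesis using less.IH p' by blast
      qed
      then obtain g where "g \<in> weighted \<sigma> s 0" "p' = q * g" by blast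
      thus ?thesis using \<mu>
        by (intro bexI[of _ "g + ?\<mu>"]) (auto simp: p'_def algebra_simps)
    qed
  qed
qed

section \<open>Integral elements\<close>

locale closed_subring =
  fixes B :: "'a::comm_ring_1 set"
  assumes one [intro, simp]: "1 \<in> B"
    and diff [intro]: "a \<in> B \<Longrightarrow> b \<in> B \<Longrightarrow> a - b \<in> B"
    and mult [intro]: "a \<in> B \<Longrightarrow> b \<in> B \<Longrightarrow> a * b \<in> B"
begin

lemma zero [intro, simp]: "0 \<in> B" using diff[of 1 1] by simp
lemma uminus [intro]: "a \<in> B \<Longrightarrow> - a \<in> B" using diff[of 0 a] by simp
lemma add [intro]: "a \<in> B \<Longrightarrow> b \<in> B \<Longrightarrow> a + b \<in> B" using diff[of a "- b"] uminus[of b] by simp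
lemma sum [intro]: "(\<And>i. i \<in> I \<Longrightarrow> g i \<in> B) \<Longrightarrow> Groups_Big.sum g I \<in> B"
  by (induction I rule: infinite_finite_induct) auto
lemma prod: "(\<And>i. i \<in> I \<Longrightarrow> g i \<in> B) \<Longrightarrow> Groups_Big.prod g I \<in> B"
  by (induction I rule: infinite_finite_induct) auto
lemma power [intro]: "a \<in> B \<Longrightarrow> a ^ i \<in> B"
  by (induction i) auto

lemma closed_subring_poly: "closed_subring {p. \<forall>i. Polynomial.coeff p i \<in> B}"
proof
  show "1 \<in> {p. \<forall>i. Polynomial.coeff p i \<in> B}" by (auto simp: coeff_1)
qed (auto simp: coeff_mult)

end

text \<open>The determinant trick: \<open>z\<close> is an eigenvalue of the matrix \<open>a\<close> with the eigenvector \<open>y\<close>, hence a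
  root of its characteristic polynomial, whose coefficients lie in \<open>B\<close>.\<close>

lemma integral_over_stable_span:
  fixes B :: "'a::idom set" and y :: "nat \<Rightarrow> 'a"
  assumes "closed_subring B"
    and a: "\<And>i l. i < N \<Longrightarrow> l < N \<Longrightarrow> a i l \<in> B"
    and eq: "\<And>i. i < N \<Longrightarrow> z * y i = (\<Sum>l<N. a i l * y l)"
    and nz: "i0 < N" "y i0 \<noteq> 0"
  shows "integral_over B z"
proof -
  interpret closed_subring B by fact
  interpret P: closed_subring "{p. \<forall>i. Polynomial.coeff p i \<in> B}" by (rule closed_subring_poly)
  define A where "A = mat N N (\<lambda>(i, l). a i l)"
  have A: "A \<in> carrier_mat N N" by (simp add: A_def)
  define Z where "Z = mat N N (\<lambda>(i, l). (if i = l then z else 0) - a i l)"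
  have Z: "Z \<in> carrier_mat N N" by (simp add: Z_def)
  have "poly (char_poly A) z = det Z" unfolding char_poly_def
    by (rule poly_det_cong[OF Z]) (auto simp: char_poly_matrix_def A_def Z_def)
  also have "det Z = 0"
    unfolding det_0_iff_vec_prod_zero[OF Z]
  proof (intro exI conjI)
    show "vec N y \<in> carrier_vec N" by simp
    show "vec N y \<noteq> 0\<^sub>v N" using nz by (metis index_vec index_zero_vec(1))
    show "Z *\<^sub>v vec N y = 0\<^sub>v N"
    proof (rule eq_vecI)
      fix i assume "i < dim_vec (0\<^sub>v N :: 'a vec)"
      hence i: "i < N" by simp
      have "(Z *\<^sub>v vec N y) $ i = (\<Sum>l<N. ((if i = l then z else 0) - a i l) * y l)"
        using i by (simp add: Z_def scalar_prod_def row_def atLeast0LessThan)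
      also have "\<dots> = (\<Sum>l<N. (if i = l then z * y l else 0)) - (\<Sum>l<N. a i l * y l)"
        unfolding sum_subtractf[symmetric] by (rule sum.cong) (auto simp: algebra_simps)
      also have "\<dots> = 0" using i eq[OF i] by simp
      finally show "(Z *\<^sub>v vec N y) $ i = 0\<^sub>v N $ i" using i by simp
    qed (simp add: Z_def)
  qed
  finally have "poly (char_poly A) z = 0" .
  moreover have "lead_coeff (char_poly A) = 1" using degree_monic_char_poly[OF A] by simp
  moreover have "\<forall>i. Polynomial.coeff (char_poly A) i \<in> B"
  proof -
    have signof: "signof p \<in> {p. \<forall>i. Polynomial.coeff p i \<in> B}" for p :: "nat \<Rightarrow> nat"
      by (cases p rule: sign_cases) (auto simp: coeff_1)
    have entry: "char_poly_matrix A $$ (i, l) \<in> {p. \<forall>i. Polynomial.coeff p i \<in> B}"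
      if "i < N" "l < N" for i l
      using that a by (auto simp: char_poly_matrix_def A_def coeff_pCons split: nat.splits)
    have "char_poly A \<in> {p. \<forall>i. Polynomial.coeff p i \<in> B}"
      unfolding char_poly_def det_def'[OF char_poly_matrix_closed[OF A]]
      by (intro P.sum P.mult P.prod signof entry) (auto simp: permutes_def)
    thus ?thesis by simp
  qed
  ultimately show ?thesis unfolding integral_over_def by blast
qed

text \<open>An equation of degree \<open>N\<close> expresses the \<open>N\<close>-th power of \<open>p/q\<close> by lower powers, so \<open>q\<^sup>N\<close> is a
  denominator of all powers of \<open>p/q\<close>.\<close>

lemma integral_over_Fract_common_denominator:
  fixes B :: "'a::idom set"
  assumes "closed_subring B" and pq: "p \<in> B" "q \<in> B" "q \<noteq> 0"
    and int: "integral_over (to_fract ` B) (Fract p q)"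
  obtains N where "\<And>i. \<exists>r\<in>B. q ^ N * p ^ i = q ^ i * r"
proof -
  interpret closed_subring B by fact
  interpret to_fract: inj_comm_ring_hom "to_fract :: 'a \<Rightarrow> 'a fract" by unfold_locales auto
  obtain P where P: "lead_coeff P = 1" "\<And>i. Polynomial.coeff P i \<in> to_fract ` B" "poly P (Fract p q) = 0"
    using int unfolding integral_over_def by blast
  define N where "N = degree P"
  obtain b where b: "\<And>i. b i \<in> B" "\<And>i. Polynomial.coeff P i = to_fract (b i)"
  proof (rule that)
    show "inv_into B to_fract (Polynomial.coeff P i) \<in> B"
      "Polynomial.coeff P i = to_fract (inv_into B to_fract (Polynomial.coeff P i))" for i
      using P(2)[of i] by (simp_all only: inv_into_into f_inv_into_f)
  qed
  have "to_fract (b N) = to_fract 1" using P(1) b(2)[of N] by (simp add: N_def)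
  hence bN: "b N = 1" by (simp only: to_fract_eq_iff)
  have "to_fract (\<Sum>i\<le>N. b i * (p ^ i * q ^ (N - i))) = to_fract q ^ N * poly P (Fract p q)"
  proof -
    have *: "to_fract q ^ N * Fract p q ^ i = to_fract (p ^ i * q ^ (N - i))" if "i \<le> N" for i
    proof -
      have "to_fract q ^ N = to_fract q ^ (N - i) * to_fract q ^ i"
        using that by (simp flip: power_add)
      thus ?thesis using pq by (simp add: Fract_conv_to_fract power_divide to_fract.hom_power)
    qed
    have "to_fract q ^ N * poly P (Fract p q)
        = (\<Sum>i\<le>N. to_fract (b i) * (to_fract q ^ N * Fract p q ^ i))"
      by (simp add: poly_altdef N_def b(2) sum_distrib_left ac_simps)
    also have "\<dots> = (\<Sum>i\<le>N. to_fract (b i * (p ^ i * q ^ (N - i))))"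
      by (intro sum.cong) (simp_all add: *)
    finally show ?thesis by (simp add: to_fract.hom_sum)
  qed
  with P(3) have "to_fract (\<Sum>i\<le>N. b i * (p ^ i * q ^ (N - i))) = 0" by (simp only: mult_zero_right)
  hence "(\<Sum>i\<le>N. b i * (p ^ i * q ^ (N - i))) = 0" by (simp only: to_fract_eq_0_iff)
  hence pN: "p ^ N = - (\<Sum>i<N. b i * (p ^ i * q ^ (N - i)))"
    by (simp add: lessThan_Suc_atMost[symmetric] bN eq_neg_iff_add_eq_0 add.commute)
  have "\<exists>r\<in>B. q ^ N * p ^ i = q ^ i * r" for i
  proof (induction i rule: less_induct)
    case (less i)
    show ?case
    proof (cases "i < N")
      case True
      have "q ^ N * p ^ i = q ^ i * (q ^ (N - i) * p ^ i)"
        using True power_add[of q i "N - i"] by simp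
      thus ?thesis using pq by blast
    next
      case False
      have "\<forall>l<N. \<exists>r\<in>B. q ^ N * p ^ (i - N + l) = q ^ (i - N + l) * r"
        using False by (intro allI impI less.IH) simp
      then obtain r where r: "\<And>l. l < N \<Longrightarrow> r l \<in> B"
        "\<And>l. l < N \<Longrightarrow> q ^ N * p ^ (i - N + l) = q ^ (i - N + l) * r l" unfolding Bex_def by metis
      have "q ^ N * p ^ i = q ^ N * p ^ (i - N) * p ^ N"
        using False by (simp add: mult.assoc flip: power_add)
      also have "\<dots> = - (\<Sum>l<N. b l * q ^ (N - l) * (q ^ N * p ^ (i - N + l)))"
        unfolding pN by (simp add: sum_distrib_left power_add ac_simps)
      also have "(\<Sum>l<N. b l * q ^ (N - l) * (q ^ N * p ^ (i - N + l))) = (\<Sum>l<N. q ^ i * (b l * r l))"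
      proof (rule sum.cong)
        fix l assume "l \<in> {..<N}"
        hence "q ^ i = q ^ (N - l) * q ^ (i - N + l)" using False by (simp flip: power_add)
        thus "b l * q ^ (N - l) * (q ^ N * p ^ (i - N + l)) = q ^ i * (b l * r l)"
          using r \<open>l \<in> {..<N}\<close> by simp
      qed simp
      finally have "q ^ N * p ^ i = q ^ i * - (\<Sum>l<N. b l * r l)" by (simp add: sum_distrib_left)
      moreover have "- (\<Sum>l<N. b l * r l) \<in> B" using b r by (intro uminus sum mult) auto
      ultimately show ?thesis by blast
    qed
  qed
  thus thesis by (rule that)
qed

lemma integral_over_to_fract:
  fixes z :: "'a::idom"
  assumes "integral_over B z" shows "integral_over (to_fract ` B) (to_fract z)"
proof -
  obtain P where P: "lead_coeff P = 1" "\<And>i. Polynomial.coeff P i \<in> B" "poly P z = 0"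
    using assms unfolding integral_over_def by blast
  interpret inj_comm_ring_hom "to_fract :: 'a \<Rightarrow> 'a fract" by unfold_locales auto
  show ?thesis unfolding integral_over_def
    by (rule exI[of _ "map_poly to_fract P"]) (use P in auto)
qed

section \<open>Rees algebras and monomials\<close>

lemma form_iff_xdeg: "form e p \<longleftrightarrow> (\<forall>\<tau>\<in>keys p. int (xdeg \<tau>) = e)"
  by (simp add: form_def xdeg_def)

lemma closed_subring_Rees: "closed_subring (Rees s N :: 'k::comm_ring_1 wpoly set)"
proof
  show "1 \<in> Rees s N" using Rees_const[of 1 s N] by (simp only: single_one)
  fix a b :: "'k wpoly" assume *: "a \<in> Rees s N" "b \<in> Rees s N"
  show "a * b \<in> Rees s N" using * by (rule Rees_mult)
  have "a + single 0 (-1) * b \<in> Rees s N" using * by (intro Rees_add Rees_mult Rees_const)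
  thus "a - b \<in> Rees s N" by (simp add: single_uminus)
qed

lemma closed_subring_weighted: "closed_subring (weighted \<sigma> s 0)"
proof
  show "1 \<in> weighted \<sigma> s 0" using weighted_const[of 0 1 \<sigma> s] by simp
  show "a * b \<in> weighted \<sigma> s 0" if "a \<in> weighted \<sigma> s 0" "b \<in> weighted \<sigma> s 0" for a b
    using weighted_mult[OF that] by simp
qed (rule weighted_diff)

lemma single_1_eq_iff: "single x (1::nat) = single i 1 \<longleftrightarrow> x = i"
  by (metis keys_single singleton_inject one_neq_zero)

lemma keys_lin:
  assumes "t \<in> keys (lin s v)"
  obtains i where "i < s" "t = single i 1" "v i \<noteq> 0"
proof -
  obtain i where i: "i < s" "t \<in> keys (single (single i 1) (v i))"
    using assms keys_sum[of "\<lambda>i. single (single i 1) (v i)" "{..<s}"] unfolding lin_def by blast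
  thus thesis using that[of i] by (cases "v i = 0") simp_all
qed

lemma lookup_lin: 
  assumes "i < s" shows "lookup (lin s v) (single i 1) = v i"
proof -
  have "lookup (lin s v) (single i 1) = (\<Sum>l<s. if l = i then v l else 0)"
    unfolding lin_def lookup_sum
    by (rule sum.cong) (simp_all add: lookup_single when_def single_1_eq_iff del: One_nat_def)
  thus ?thesis using assms by simp
qed

lemma lin_in_weighted:
  assumes "\<And>i \<tau>. i < s \<Longrightarrow> \<tau> \<in> keys (v i) \<Longrightarrow> k + \<sigma> i \<le> xdeg \<tau>"
  shows "lin s v \<in> weighted \<sigma> s k"
  unfolding weighted_def
proof clarify
  fix t assume "t \<in> keys (lin s v)"
  then obtain i where i: "i < s" "t = single i 1" by (rule keys_lin)
  thus "keys t \<subseteq> {..<s} \<and> (\<forall>\<tau>\<in>keys (lookup (lin s v) t). k + wdeg \<sigma> t \<le> xdeg \<tau>)"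
    using assms i lookup_lin[OF i(1), of v] by simp
qed

lemma lin_unit: 
  assumes "i < s" shows "lin s (\<lambda>l. if l = i then r else 0) = single (single i 1) r"
proof -
  have "lin s (\<lambda>l. if l = i then r else 0) = (\<Sum>l<s. if l = i then single (single i 1) r else 0)"
    unfolding lin_def by (rule sum.cong) auto
  thus ?thesis using assms by simp
qed

lemma lin_sum: "lin s (\<lambda>i. \<Sum>j\<in>J. r j * \<epsilon> j i) = (\<Sum>j\<in>J. single 0 (r j) * lin s (\<epsilon> j))"
proof -
  have "lin s (\<lambda>i. \<Sum>j\<in>J. r j * \<epsilon> j i) = (\<Sum>i<s. \<Sum>j\<in>J. single (single i 1) (r j * \<epsilon> j i))"
    by (simp add: lin_def single_sum)
  also have "\<dots> = (\<Sum>j\<in>J. \<Sum>i<s. single (single i 1) (r j * \<epsilon> j i))" by (rule sum.swap)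
  finally show ?thesis by (simp add: lin_def sum_distrib_left mult_single)
qed

text \<open>The divisor of degree \<open>a\<close> takes as many factors \<open>x\<^sub>0\<close> as possible.\<close>

lemma split_xdeg:
  assumes "a \<le> xdeg \<tau>"
  obtains \<alpha> \<upsilon> where "\<alpha> \<le> a" "\<tau> = single False \<alpha> + single True (a - \<alpha>) + \<upsilon>" "xdeg \<upsilon> = xdeg \<tau> - a"
proof -
  define \<alpha> where "\<alpha> = min a (lookup \<tau> False)"
  define \<upsilon> where "\<upsilon> = \<tau> - (single False \<alpha> + single True (a - \<alpha>))"
  have "a \<le> lookup \<tau> False + lookup \<tau> True" using assms by (simp add: xdeg_def UNIV_bool)
  have \<tau>: "\<tau> = single False \<alpha> + single True (a - \<alpha>) + \<upsilon>"
    using \<open>a \<le> lookup \<tau> False + lookup \<tau> True\<close>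
    by (intro poly_mapping_eqI)
      (auto simp: \<upsilon>_def \<alpha>_def lookup_add lookup_minus lookup_single when_def split: bool.splits)
  have "xdeg \<tau> = a + xdeg \<upsilon>" using arg_cong[OF \<tau>, of xdeg] by (simp add: \<alpha>_def)
  thus thesis using that[of \<alpha>, OF _ \<tau>] by (simp add: \<alpha>_def)
qed

lemma monomial_split:
  assumes "i \<in> keys t"
  obtains t' where "t = single i (1::nat) + t'" "keys t' \<subseteq> keys t"
proof (rule that)
  show t: "t = single i 1 + (t - single i 1)"
    using assms by (auto intro!: poly_mapping_eqI simp: lookup_add lookup_minus lookup_single when_def in_keys_iff)
  show "keys (t - single i 1) \<subseteq> keys t" by (auto simp: in_keys_iff lookup_minus)
qed

section \<open>Powers of the irrelevant ideal\<close>

text \<open>The monomials of degree \<open>K\<close> in \<open>x\<^sub>0, x\<^sub>1\<close> are the \<open>xmon K \<alpha>\<close> with \<open>\<alpha> \<le> K\<close>.\<close>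

definition xmon :: "nat \<Rightarrow> nat \<Rightarrow> 'k::comm_ring_1 wpoly" where
  "xmon K \<alpha> = mono_xw 1 (single False \<alpha> + single True (K - \<alpha>)) 0"

text \<open>The elements of the product of the \<open>K\<close>-th power of the irrelevant ideal with \<open>B\<close>.\<close>
definition mpower_span :: "nat \<Rightarrow> 'k::comm_ring_1 wpoly set \<Rightarrow> 'k wpoly set" where
  "mpower_span K B = {\<Sum>\<alpha>\<le>K. b \<alpha> * xmon K \<alpha> |b. \<forall>\<alpha>. b \<alpha> \<in> B}"

context
  fixes B :: "'k::comm_ring_1 wpoly set"
  assumes B: "closed_subring B"
begin

interpretation closed_subring B by (rule B)

lemma mpower_span_add: "p \<in> mpower_span K B \<Longrightarrow> q \<in> mpower_span K B \<Longrightarrow> p + q \<in> mpower_span K B"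
  unfolding mpower_span_def
proof clarify
  fix b c :: "nat \<Rightarrow> 'k wpoly" assume "\<forall>\<alpha>. b \<alpha> \<in> B" "\<forall>\<alpha>. c \<alpha> \<in> B"
  thus "\<exists>d. (\<Sum>\<alpha>\<le>K. b \<alpha> * xmon K \<alpha>) +
      (\<Sum>\<alpha>\<le>K. c \<alpha> * xmon K \<alpha>) =
      (\<Sum>\<alpha>\<le>K. d \<alpha> * xmon K \<alpha>) \<and> (\<forall>\<alpha>. d \<alpha> \<in> B)"
    by (intro exI[of _ "\<lambda>\<alpha>. b \<alpha> + c \<alpha>"]) (auto simp: sum.distrib distrib_right)
qed

lemma mpower_span_0: "0 \<in> mpower_span K B"
  unfolding mpower_span_def by (auto intro!: exI[of _ "\<lambda>_. 0"])

lemma mpower_span_sum: "(\<And>i. i \<in> I \<Longrightarrow> g i \<in> mpower_span K B) \<Longrightarrow> Groups_Big.sum g I \<in> mpower_span K B"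
  by (induction I rule: infinite_finite_induct) (auto intro: mpower_span_add mpower_span_0)

lemma mpower_span_mult: "a \<in> B \<Longrightarrow> q \<in> mpower_span K B \<Longrightarrow> a * q \<in> mpower_span K B"
  unfolding mpower_span_def
proof clarify
  fix b :: "nat \<Rightarrow> 'k wpoly" assume "\<forall>\<alpha>. b \<alpha> \<in> B" "a \<in> B"
  thus "\<exists>d. a * (\<Sum>\<alpha>\<le>K. b \<alpha> * xmon K \<alpha>) =
      (\<Sum>\<alpha>\<le>K. d \<alpha> * xmon K \<alpha>) \<and> (\<forall>\<alpha>. d \<alpha> \<in> B)"
    by (intro exI[of _ "\<lambda>\<alpha>. a * b \<alpha>"]) (auto simp: sum_distrib_left mult.assoc)
qed

lemma mpower_span_mono:
  assumes scalars: "\<And>r. single 0 r \<in> B" and "K \<le> xdeg \<tau>"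
  shows "mono_xw c \<tau> 0 \<in> mpower_span K B"
proof -
  obtain \<alpha> \<upsilon> where \<alpha>: "\<alpha> \<le> K" and \<tau>: "\<tau> = single False \<alpha> + single True (K - \<alpha>) + \<upsilon>"
    using split_xdeg[OF assms(2)] by metis
  define b where "b = (\<lambda>\<beta>. if \<beta> = \<alpha> then mono_xw c \<upsilon> 0 else 0)"
  have "(\<Sum>\<beta>\<le>K. b \<beta> * xmon K \<beta>) = (\<Sum>\<beta>\<le>K. if \<beta> = \<alpha> then mono_xw c \<upsilon> 0 * xmon K \<alpha> else 0)"
    by (rule sum.cong) (auto simp: b_def)
  also have "\<dots> = mono_xw c \<tau> 0"
    using \<alpha> by (simp add: xmon_def mult_single \<tau> ac_simps)
  finally have "mono_xw c \<tau> 0 = (\<Sum>\<beta>\<le>K. b \<beta> * xmon K \<beta>)" ..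
  moreover have "\<forall>\<beta>. b \<beta> \<in> B" using scalars by (simp add: b_def)
  ultimately show ?thesis unfolding mpower_span_def by blast
qed

text \<open>A factor \<open>x\<^sup>\<beta> w\<^sub>i\<close> of weight \<open>K\<close> is split off a monomial. By hypothesis it is a combination of the
  \<open>W j\<close> with coefficients \<open>q j\<close> of degree \<open>K\<close>; moved to the remaining factor, whose weight may have
  dropped to 0, these coefficients raise its weight back to \<open>K\<close>. Induction on the number of factors
  \<open>w\<close> then leaves the case of monomials in \<open>x\<close> of degree at least \<open>K\<close>.\<close>

lemma weighted_subset_mpower_span:
  fixes W :: "nat \<Rightarrow> 'k wpoly"
  assumes scalars: "\<And>r. single 0 r \<in> B" and W: "\<And>j. j < n \<Longrightarrow> W j \<in> B"
    and gen: "\<And>i \<tau>. i < s \<Longrightarrow> xdeg \<tau> = K + \<sigma> i \<Longrightarrow>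
       \<exists>r. (\<forall>j<n. form (int K) (r j)) \<and> mono_xw 1 \<tau> (single i 1) = (\<Sum>j<n. single 0 (r j) * W j)"
    and p: "p \<in> weighted \<sigma> s K"
  shows "p \<in> mpower_span K B"
proof -
  have main: "single t r \<in> mpower_span K B"
    if "keys t \<subseteq> {..<s}" "\<And>\<tau>. \<tau> \<in> keys r \<Longrightarrow> K + wdeg \<sigma> t \<le> xdeg \<tau>" for t r
    using that
  proof (induction "wdeg (\<lambda>_. 1) t" arbitrary: t r rule: less_induct)
    case less
    have "mono_xw (lookup r \<tau>) \<tau> t \<in> mpower_span K B" if \<tau>: "\<tau> \<in> keys r" for \<tau>
    proof (cases "t = 0")
      case True
      thus ?thesis using less.prems(2)[OF \<tau>] mpower_span_mono[OF scalars, of K \<tau>] by simp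
    next
      case False
      define c where "c = lookup r \<tau>"
      obtain i where i: "i \<in> keys t" using False by (metis keys_eq_empty ex_in_conv)
      hence i_s: "i < s" using less.prems(1) by auto
      obtain t' where t: "t = single i 1 + t'" and "keys t' \<subseteq> keys t" using i by (rule monomial_split)
      with less.prems(1) have t's: "keys t' \<subseteq> {..<s}" by blast
      have "K + \<sigma> i + wdeg \<sigma> t' \<le> xdeg \<tau>" using less.prems(2)[OF \<tau>] by (simp add: t)
      then obtain \<alpha> \<upsilon> where "\<alpha> \<le> K + \<sigma> i" and \<tau>_eq: "\<tau> = single False \<alpha> + single True (K + \<sigma> i - \<alpha>) + \<upsilon>"
        and \<upsilon>: "wdeg \<sigma> t' \<le> xdeg \<upsilon>"
        using split_xdeg[of "K + \<sigma> i" \<tau>] by (metis add_leD1 le_diff_conv2 add.commute)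
      then obtain q where q: "\<And>j. j < n \<Longrightarrow> form (int K) (q j)"
        "mono_xw 1 (single False \<alpha> + single True (K + \<sigma> i - \<alpha>)) (single i 1) = (\<Sum>j<n. single 0 (q j) * W j)"
        using gen[OF i_s, of "single False \<alpha> + single True (K + \<sigma> i - \<alpha>)"] by auto
      have "mono_xw c \<tau> t = mono_xw 1 (single False \<alpha> + single True (K + \<sigma> i - \<alpha>)) (single i 1) * mono_xw c \<upsilon> t'"
        by (simp add: mult_single t \<tau>_eq)
      also have "\<dots> = (\<Sum>j<n. W j * single t' (q j * single \<upsilon> c))"
        unfolding q(2) sum_distrib_right by (rule sum.cong) (simp_all add: mult.assoc mult.left_commute mult_single)
      also have "\<dots> \<in> mpower_span K B"
      proof (intro mpower_span_sum mpower_span_mult less.hyps W t's)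
        show "wdeg (\<lambda>_. 1) t' < wdeg (\<lambda>_. 1) t" by (simp add: t)
        fix j \<tau>' assume j: "j \<in> {..<n}" and "\<tau>' \<in> keys (q j * single \<upsilon> c)"
        with keys_mult[of "q j" "single \<upsilon> c"] obtain \<beta> where "\<beta> \<in> keys (q j)" "\<tau>' = \<beta> + \<upsilon>"
          by (auto split: if_splits)
        thus "K + wdeg \<sigma> t' \<le> xdeg \<tau>'" using q(1) j \<upsilon> by (force simp: form_iff_xdeg)
      qed auto
      finally show ?thesis unfolding c_def .
    qed
    hence "(\<Sum>\<tau>\<in>keys r. mono_xw (lookup r \<tau>) \<tau> t) \<in> mpower_span K B" by (rule mpower_span_sum)
    also have "(\<Sum>\<tau>\<in>keys r. mono_xw (lookup r \<tau>) \<tau> t) = single t r"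
      using arg_cong[OF single_sum_keys[of r], of "single t"] by (simp add: single_sum)
    finally show ?case .
  qed
  have "(\<Sum>t\<in>keys p. single t (lookup p t)) \<in> mpower_span K B"
    by (intro mpower_span_sum main) (use p in \<open>auto simp: weighted_def\<close>)
  thus ?thesis using single_sum_keys[of p] by simp
qed

end

lemma sum_of_pieces_gr_xdeg:
  assumes "v \<in> sum_of_pieces {0..} (gr (free_module s (\<lambda>i. int (\<sigma> i))))" "i < s" "\<tau> \<in> keys (v i)"
  shows "\<sigma> i \<le> xdeg \<tau>"
proof -
  obtain L g where v: "v = (\<Sum>e\<in>L. g e)" "L \<subseteq> {0..}" "\<And>e. e \<in> L \<Longrightarrow> g e \<in> gr (free_module s (\<lambda>i. int (\<sigma> i))) e"
    using assms(1) unfolding sum_of_pieces_def by blast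
  have "v i = (\<Sum>e\<in>L. g e i)" unfolding v(1) by (induction L rule: infinite_finite_induct) auto
  with assms(3) keys_sum[of "\<lambda>e. g e i" L] obtain e where e: "e \<in> L" "\<tau> \<in> keys (g e i)" by auto
  have "form (e + int (\<sigma> i)) (g e i)" using v(3)[OF e(1)] assms(2) by (simp add: free_module_def)
  hence "int (xdeg \<tau>) = e + int (\<sigma> i)" using e(2) by (simp add: form_iff_xdeg)
  thus ?thesis using v(2) e(1) by auto
qed

lemma Rees_subset_weighted:
  fixes N :: "(nat \<Rightarrow> 'k::comm_ring_1 bpoly) set"
  assumes "\<And>v i \<tau>. v \<in> N \<Longrightarrow> i < s \<Longrightarrow> \<tau> \<in> keys (v i) \<Longrightarrow> \<sigma> i \<le> xdeg \<tau>"
  shows "Rees s N \<subseteq> weighted \<sigma> s 0"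
proof
  interpret closed_subring "weighted \<sigma> s 0 :: 'k wpoly set" by (rule closed_subring_weighted)
  fix p assume "p \<in> Rees s N"
  thus "p \<in> weighted \<sigma> s 0"
  proof induction
    case (Rees_lin v)
    show ?case by (rule lin_in_weighted) (use assms[OF Rees_lin] in simp)
  qed (auto intro: weighted_const)
qed

text \<open>A monomial of nonnegative weight is the product of factors \<open>x\<^sup>\<beta> w\<^sub>i\<close> of weight 0, which belong to
  \<open>M\<close>, and of a monomial in \<open>x\<close>.\<close>

lemma Rees_nonneg_part_eq_weighted:
  fixes M :: "(nat \<Rightarrow> 'k::comm_ring_1 bpoly) set"
  assumes M: "M = sum_of_pieces {0..} (gr (free_module s (\<lambda>i. int (\<sigma> i))))"
  shows "Rees s M = weighted \<sigma> s 0"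
proof
  show "Rees s M \<subseteq> weighted \<sigma> s 0"
    by (rule Rees_subset_weighted) (use sum_of_pieces_gr_xdeg M in blast)
  interpret closed_subring "Rees s M" by (rule closed_subring_Rees)
  show "weighted \<sigma> s 0 \<subseteq> Rees s M"
  proof
    fix p :: "'k wpoly" assume "p \<in> weighted \<sigma> s 0"
    thus "p \<in> Rees s M"
    proof (induction rule: weighted_induct)
      case (mono c \<tau> t)
      thus ?case
      proof (induction "wdeg (\<lambda>_. 1) t" arbitrary: t \<tau> rule: less_induct)
        case less
        show ?case
        proof (cases "t = 0")
          case True
          thus ?thesis by (simp add: Rees_const)
        next
          case False
          then obtain i where i: "i \<in> keys t" by (metis keys_eq_empty ex_in_conv)
          then obtain t' where t: "t = single i 1 + t'" "keys t' \<subseteq> keys t" by (rule monomial_split)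
          have i_s: "i < s" using i less.prems(1) by auto
          have "\<sigma> i + wdeg \<sigma> t' \<le> xdeg \<tau>" using less.prems(2) by (simp add: t)
          then obtain \<alpha> \<upsilon> where \<alpha>: "\<alpha> \<le> \<sigma> i" and \<tau>: "\<tau> = single False \<alpha> + single True (\<sigma> i - \<alpha>) + \<upsilon>"
            and \<upsilon>: "wdeg \<sigma> t' \<le> xdeg \<upsilon>"
            using split_xdeg[of "\<sigma> i" \<tau>] by (metis add_leD1 le_diff_conv2 add.commute)
          define \<beta> where "\<beta> = single False \<alpha> + single True (\<sigma> i - \<alpha>)"
          define v :: "nat \<Rightarrow> 'k bpoly" where "v = (\<lambda>l. if l = i then single \<beta> 1 else 0)"
          have "xdeg \<beta> = \<sigma> i" using \<alpha> by (simp add: \<beta>_def)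
          hence "v \<in> gr (free_module s (\<lambda>i. int (\<sigma> i))) 0"
            using i_s by (simp add: v_def free_module_def form_iff_xdeg)
          hence "v \<in> M" unfolding M sum_of_pieces_def
            by (intro CollectI exI[of _ "{0}"] exI[of _ "\<lambda>_. v"]) auto
          moreover have "lin s v = mono_xw 1 \<beta> (single i 1)"
            unfolding v_def by (rule lin_unit[OF i_s])
          ultimately have "mono_xw 1 \<beta> (single i 1) \<in> Rees s M" by (metis Rees_lin)
          moreover have "mono_xw c \<upsilon> t' \<in> Rees s M"
            using less.prems(1) t(2) \<upsilon> by (intro less.hyps) (auto simp: t(1))
          ultimately have "mono_xw 1 \<beta> (single i 1) * mono_xw c \<upsilon> t' \<in> Rees s M" by (rule Rees_mult)
          thus ?thesis by (simp add: mult_single t(1) \<tau> \<beta>_def)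
        qed
      qed
    qed auto
  qed
qed

lemma xmon_in_weighted: "\<alpha> \<le> K \<Longrightarrow> xmon K \<alpha> \<in> weighted \<sigma> s K"
  unfolding xmon_def by (rule mono_xw_in_weighted) auto

lemma xmon_nonzero: "xmon K \<alpha> \<noteq> (0 :: 'k::comm_ring_1 wpoly)"
  by (simp add: xmon_def single_eq_0_iff)

lemma bipiece_Rees_free_subset_weighted:
  assumes "int K \<le> k" shows "Rees_free s \<inter> bipiece \<sigma> k j \<subseteq> weighted \<sigma> s K"
proof
  fix p assume p: "p \<in> Rees_free s \<inter> bipiece \<sigma> k j"
  show "p \<in> weighted \<sigma> s K" unfolding weighted_def
  proof (intro CollectI ballI conjI)
    fix t assume t: "t \<in> keys p"
    show "keys t \<subseteq> {..<s}" using p t by (auto simp: Rees_free_def)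
    fix \<tau> assume "\<tau> \<in> keys (lookup p t)"
    moreover have "form (k + (\<Sum>i\<in>keys t. int (\<sigma> i) * int (lookup t i))) (lookup p t)"
      using p t by (simp add: bipiece_def)
    ultimately have "int (xdeg \<tau>) = k + int (wdeg \<sigma> t)" by (simp add: form_iff_xdeg wdeg_def)
    thus "K + wdeg \<sigma> t \<le> xdeg \<tau>" using assms by simp
  qed
qed

lemma bitruncation_cong:
  assumes "\<And>k j. i \<le> k \<Longrightarrow> A \<inter> bipiece \<sigma> k j = A' \<inter> bipiece \<sigma> k j"
  shows "bitruncation \<sigma> i A = bitruncation \<sigma> i A'"
proof -
  have "(case x of (k, j) \<Rightarrow> A \<inter> bipiece \<sigma> k j) = (case x of (k, j) \<Rightarrow> A' \<inter> bipiece \<sigma> k j)"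
    if "x \<in> {(k, j). i \<le> k}" for x
    using that by (cases x) (simp add: assms)
  hence "(\<forall>x\<in>L. g x \<in> (case x of (k, j) \<Rightarrow> A \<inter> bipiece \<sigma> k j)) \<longleftrightarrow>
     (\<forall>x\<in>L. g x \<in> (case x of (k, j) \<Rightarrow> A' \<inter> bipiece \<sigma> k j))" if "L \<subseteq> {(k, j). i \<le> k}" for L g
    using that by (intro ball_cong refl) (simp only: subset_eq)
  thus ?thesis unfolding bitruncation_def sum_of_pieces_def
    by (intro Collect_cong ex_cong1 conj_cong refl)
qed

section \<open>Consequences of generation in one degree\<close>

text \<open>The hypothesis \<open>gen\<close> says that the component of \<open>F\<close> in degree \<open>K\<close> is spanned over the forms of
  degree \<open>K\<close> by elements \<open>\<epsilon> j\<close> of \<open>E\<close>. By \<open>weighted_subset_mpower_span\<close>,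
  everything of weight at least \<open>K\<close> then lies in the ideal of \<open>\<R>(E)\<close> generated by the monomials of
  degree \<open>K\<close> in \<open>x\<close>. In particular an element of \<open>\<R>(M)\<close> multiplies this finitely
  generated ideal into itself, which makes it integral over \<open>\<R>(E)\<close> and makes \<open>x\<^sub>1\<^sup>K\<close> a denominator for it. Conversely, nothing outside \<open>\<R>(M)\<close> is
  integral, because \<open>\<R>(M)\<close> is completely integrally closed.\<close>

lemma Rees_comparison:
  fixes E M :: "(nat \<Rightarrow> 'k::field bpoly) set" and \<epsilon> :: "nat \<Rightarrow> nat \<Rightarrow> 'k bpoly"
  assumes M: "M = sum_of_pieces {0..} (gr (free_module s (\<lambda>i. int (\<sigma> i))))"
    and E: "\<And>v i \<tau>. v \<in> E \<Longrightarrow> i < s \<Longrightarrow> \<tau> \<in> keys (v i) \<Longrightarrow> \<sigma> i \<le> xdeg \<tau>"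
    and \<epsilon>: "\<And>j. j < n \<Longrightarrow> \<epsilon> j \<in> E"
    and gen: "\<And>i \<tau>. i < s \<Longrightarrow> xdeg \<tau> = K + \<sigma> i \<Longrightarrow>
       \<exists>r. (\<forall>j<n. form (int K) (r j)) \<and> mono_xw 1 \<tau> (single i 1) = (\<Sum>j<n. single 0 (r j) * lin s (\<epsilon> j))"
  shows "(bitruncation \<sigma> (int K) (Rees s E) = bitruncation \<sigma> (int K) (Rees s M)
          \<and> bitruncation \<sigma> (int K) (Rees s M) = bitruncation \<sigma> (int K) (Rees_free s))
       \<and> to_fract ` Rees s M = integral_closure_in (to_fract ` Rees s E) (frac_field (Rees s E))
       \<and> is_reduction_in_free s E M"
proof -
  interpret closed_subring "Rees s E" by (rule closed_subring_Rees)
  note RM = Rees_nonneg_part_eq_weighted[OF M]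
  have EM: "Rees s E \<subseteq> Rees s M" unfolding RM by (rule Rees_subset_weighted) (rule E)
  have MF: "Rees s M \<subseteq> Rees_free s" unfolding RM by (auto simp: weighted_def Rees_free_def)
  have span: "p \<in> mpower_span K (Rees s E)" if "p \<in> weighted \<sigma> s K" for p
    by (rule weighted_subset_mpower_span[OF closed_subring_Rees _ _ gen that])
      (auto intro: Rees_const Rees_lin \<epsilon>)
  have span_E: "mpower_span K (Rees s E) \<subseteq> Rees s E"
    unfolding mpower_span_def xmon_def by (auto intro!: sum mult Rees_const)
  have pieces: "Rees s E \<inter> bipiece \<sigma> k j = Rees_free s \<inter> bipiece \<sigma> k j"
    "Rees s M \<inter> bipiece \<sigma> k j = Rees_free s \<inter> bipiece \<sigma> k j" if "int K \<le> k" for k j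
    using bipiece_Rees_free_subset_weighted[OF that, of s \<sigma> j] span span_E EM MF by blast+
  have a: "bitruncation \<sigma> (int K) (Rees s E) = bitruncation \<sigma> (int K) (Rees s M)"
    "bitruncation \<sigma> (int K) (Rees s M) = bitruncation \<sigma> (int K) (Rees_free s)"
    by (rule bitruncation_cong, simp add: pieces)+
  have mult_xmon: "z * xmon K \<alpha> \<in> mpower_span K (Rees s E)" if "z \<in> Rees s M" "\<alpha> \<le> K" for z \<alpha>
    using weighted_mult[OF _ xmon_in_weighted[OF that(2)], of z \<sigma> s 0] that(1) RM span by simp
  have integral: "integral_over (Rees s E) z" if z: "z \<in> Rees s M" for z
  proof -
    have "\<forall>\<alpha>. \<exists>b. \<alpha> \<le> K \<longrightarrow> z * xmon K \<alpha> = (\<Sum>\<beta>\<le>K. b \<beta> * xmon K \<beta>) \<and> (\<forall>\<beta>. b \<beta> \<in> Rees s E)"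
      using mult_xmon[OF z] unfolding mpower_span_def by blast
    from choice[OF this] obtain b where
      "\<And>\<alpha>. \<alpha> \<le> K \<Longrightarrow> z * xmon K \<alpha> = (\<Sum>\<beta>\<le>K. b \<alpha> \<beta> * xmon K \<beta>)"
      "\<And>\<alpha> \<beta>. \<alpha> \<le> K \<Longrightarrow> b \<alpha> \<beta> \<in> Rees s E" by blast
    thus ?thesis
      by (intro integral_over_stable_span[OF closed_subring_Rees, where N = "Suc K" and a = b and y = "xmon K" and ?i0.0 = 0])
        (auto simp: lessThan_Suc_atMost less_Suc_eq_le xmon_nonzero)
  qed
  have c: "is_reduction_in_free s E M"
    unfolding is_reduction_in_free_def by (intro ballI integral Rees_lin)
  have b: "to_fract ` Rees s M = integral_closure_in (to_fract ` Rees s E) (frac_field (Rees s E))"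
  proof (intro equalityI subsetI)
    fix x assume "x \<in> to_fract ` Rees s M"
    then obtain z where z: "z \<in> Rees s M" "x = to_fract z" by blast
    have "z * xmon K 0 \<in> Rees s E" using mult_xmon[OF z(1), of 0] span_E by auto
    moreover have "xmon K 0 \<in> Rees s E" unfolding xmon_def by (rule Rees_const)
    moreover have "to_fract z = Fract (z * xmon K 0) (xmon K 0)"
      by (simp add: to_fract_def eq_fract xmon_nonzero)
    ultimately have "x \<in> frac_field (Rees s E)"
      unfolding frac_field_def z(2) using xmon_nonzero by blast
    thus "x \<in> integral_closure_in (to_fract ` Rees s E) (frac_field (Rees s E))"
      using integral_over_to_fract[OF integral[OF z(1)]] by (simp add: integral_closure_in_def z(2))
  next
    fix x assume "x \<in> integral_closure_in (to_fract ` Rees s E) (frac_field (Rees s E))"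
    then obtain p q where x: "x = Fract p q" and pq: "p \<in> Rees s E" "q \<in> Rees s E" "q \<noteq> 0"
      and int: "integral_over (to_fract ` Rees s E) (Fract p q)"
      by (auto simp: integral_closure_in_def frac_field_def)
    obtain N where N: "\<And>i. \<exists>r\<in>Rees s E. q ^ N * p ^ i = q ^ i * r"
      using integral_over_Fract_common_denominator[OF closed_subring_Rees pq int] by blast
    have "\<exists>g\<in>weighted \<sigma> s 0. p = q * g"
    proof (rule weighted_completely_integrally_closed)
      show "p \<in> weighted \<sigma> s 0" "q \<in> weighted \<sigma> s 0" using pq EM RM by blast+
      show "\<exists>r\<in>weighted \<sigma> s 0. q ^ N * p ^ i = q ^ i * r" for i using N[of i] EM RM by blast
    qed (use pq in simp_all)
    then obtain g where "g \<in> Rees s M" "p = q * g" using RM by blast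
    thus "x \<in> to_fract ` Rees s M"
      using pq(3) unfolding x by (intro image_eqI[of _ _ g]) (simp_all add: to_fract_def eq_fract)
  qed
  show ?thesis using a b c by blast
qed

section \<open>Forms in two variables\<close>

lemma form_diff [intro]: "form e p \<Longrightarrow> form e q \<Longrightarrow> form e (p - q)"
  for p q :: "'k::comm_ring_1 bpoly"
  using keys_diff[of p q] by (auto simp: form_iff_xdeg)

lemma form_mult:
  assumes "form a p" "form e q" shows "form (a + e) (p * q)"
  unfolding form_iff_xdeg
proof
  fix \<tau> assume "\<tau> \<in> keys (p * q)"
  with keys_mult[of p q] obtain t u where "t \<in> keys p" "u \<in> keys q" "\<tau> = t + u" by auto
  thus "int (xdeg \<tau>) = a + e" using assms by (simp add: form_iff_xdeg)
qed

lemma form_single: "form (int (xdeg \<tau>)) (single \<tau> c)"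
  by (simp add: form_iff_xdeg)

definition form_component :: "int \<Rightarrow> 'k::comm_ring_1 bpoly \<Rightarrow> 'k bpoly" where
  "form_component e p = (\<Sum>\<tau>\<in>{\<tau>\<in>keys p. int (xdeg \<tau>) = e}. single \<tau> (lookup p \<tau>))"

lemma lookup_form_component: "lookup (form_component e p) \<tau> = (if int (xdeg \<tau>) = e then lookup p \<tau> else 0)"
proof -
  have "lookup (form_component e p) \<tau> = (\<Sum>t\<in>{t\<in>keys p. int (xdeg t) = e}. if t = \<tau> then lookup p \<tau> else 0)"
    unfolding form_component_def lookup_sum by (rule sum.cong) (auto simp: lookup_single when_def)
  thus ?thesis by (simp add: in_keys_iff)
qed

lemma form_of_component [simp]: "form e (form_component e p)"
  by (auto simp: form_iff_xdeg in_keys_iff lookup_form_component split: if_splits)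

lemma form_component_form: "form e p \<Longrightarrow> form_component e p = p"
  by (rule poly_mapping_eqI) (auto simp: form_iff_xdeg in_keys_iff lookup_form_component)

lemma form_component_form_neq: "form e p \<Longrightarrow> e \<noteq> e' \<Longrightarrow> form_component e' p = 0"
  by (rule poly_mapping_eqI) (auto simp: form_iff_xdeg in_keys_iff lookup_form_component)

lemma form_component_add: "form_component e (p + q) = form_component e p + form_component e q"
  by (rule poly_mapping_eqI) (simp add: lookup_form_component lookup_add)

lemma form_component_0 [simp]: "form_component e 0 = 0"
  by (rule poly_mapping_eqI) (simp add: lookup_form_component)

lemma form_component_sum: "form_component e (sum g I) = (\<Sum>i\<in>I. form_component e (g i))"
  by (induction I rule: infinite_finite_induct) (simp_all add: form_component_add)

lemma form_component_mult:
  assumes "form a p" shows "form_component (a + e) (p * q) = p * form_component e q"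
proof -
  have "q = (\<Sum>\<tau>\<in>keys q. single \<tau> (lookup q \<tau>))" by (rule single_sum_keys)
  hence "form_component (a + e) (p * q) = form_component (a + e) (p * (\<Sum>\<tau>\<in>keys q. single \<tau> (lookup q \<tau>)))" by simp
  also have "\<dots> = (\<Sum>\<tau>\<in>keys q. form_component (a + e) (p * single \<tau> (lookup q \<tau>)))"
    by (simp add: sum_distrib_left form_component_sum)
  also have "\<dots> = (\<Sum>\<tau>\<in>keys q. if int (xdeg \<tau>) = e then p * single \<tau> (lookup q \<tau>) else 0)"
  proof (rule sum.cong)
    fix \<tau>
    have "form (a + int (xdeg \<tau>)) (p * single \<tau> (lookup q \<tau>))"
      by (rule form_mult[OF assms form_single])
    thus "form_component (a + e) (p * single \<tau> (lookup q \<tau>)) =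
        (if int (xdeg \<tau>) = e then p * single \<tau> (lookup q \<tau>) else 0)"
      using form_component_form[of "a + int (xdeg \<tau>)" "p * single \<tau> (lookup q \<tau>)"]
        form_component_form_neq[of "a + int (xdeg \<tau>)" "p * single \<tau> (lookup q \<tau>)" "a + e"] by auto
  qed simp
  also have "\<dots> = p * form_component e q"
    by (simp add: form_component_def sum_distrib_left sum.If_cases Int_def)
  finally show ?thesis .
qed

text \<open>The power \<open>x\<^sub>0\<^sup>N\<close> or \<open>x\<^sub>1\<^sup>N\<close>.\<close>

definition xpow :: "bool \<Rightarrow> nat \<Rightarrow> 'k::comm_ring_1 bpoly" where
  "xpow b N = single (single b N) 1"

lemma xpow_add: "xpow b (N + N') = xpow b N * xpow b N'"
  by (simp add: xpow_def mult_single single_add)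

lemma xpow_nonzero [simp]: "xpow b N \<noteq> 0" by (simp add: xpow_def single_eq_0_iff)

lemma form_xpow: "form (int N) (xpow b N)" by (simp add: xpow_def form_iff_xdeg)

lemma single_eq_xpow_mult:
  assumes "N \<le> lookup \<tau> b"
  shows "single \<tau> c = xpow b N * single (\<tau> - single b N) c"
proof -
  have "\<tau> = single b N + (\<tau> - single b N)"
    using assms by (intro poly_mapping_eqI) (auto simp: lookup_add lookup_minus lookup_single when_def)
  thus ?thesis by (simp add: xpow_def mult_single)
qed

text \<open>A monomial of degree at least \<open>2N - 1\<close> is divisible by \<open>x\<^sub>0\<^sup>N\<close> or \<open>x\<^sub>1\<^sup>N\<close>. In cohomological terms, the
  second local cohomology of \<open>R\<close> vanishes in degrees at least \<open>-1\<close>; the bound \<open>d\<^sub>m - 1\<close> of the theorem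
  originates here.\<close>

lemma high_degree_split:
  fixes c :: "'k::comm_ring_1 bpoly"
  assumes "\<And>\<tau>. \<tau> \<in> keys c \<Longrightarrow> 2 * N \<le> xdeg \<tau> + 1"
  shows "\<exists>c0 c1. c = xpow False N * c0 + xpow True N * c1"
proof -
  have *: "\<exists>c0 c1. sum g I = xpow False N * c0 + xpow True N * c1"
    if "\<And>i. i \<in> I \<Longrightarrow> \<exists>c0 c1. g i = xpow False N * c0 + xpow True N * c1"
    for g :: "(bool \<Rightarrow>\<^sub>0 nat) \<Rightarrow> 'k bpoly" and I
    using that
  proof (induction I rule: infinite_finite_induct)
    case (insert x F)
    then obtain c0 c1 d0 d1 where "g x = xpow False N * c0 + xpow True N * c1"
      "sum g F = xpow False N * d0 + xpow True N * d1" by (metis insertCI)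
    thus ?case using insert.hyps
      by (intro exI[of _ "c0 + d0"] exI[of _ "c1 + d1"]) (simp add: algebra_simps)
  qed (auto intro!: exI[of _ 0])
  have "\<exists>c0 c1. single \<tau> (lookup c \<tau>) = xpow False N * c0 + xpow True N * c1" if "\<tau> \<in> keys c" for \<tau>
  proof -
    have "N \<le> lookup \<tau> False \<or> N \<le> lookup \<tau> True"
      using assms[OF that] by (auto simp: xdeg_def UNIV_bool)
    thus ?thesis using single_eq_xpow_mult[of N \<tau> _ "lookup c \<tau>"]
      by (metis add.left_neutral add.right_neutral mult_zero_right)
  qed
  hence "\<exists>c0 c1. (\<Sum>\<tau>\<in>keys c. single \<tau> (lookup c \<tau>)) = xpow False N * c0 + xpow True N * c1"
    by (rule *)
  thus ?thesis unfolding single_sum_keys[of c, symmetric] .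
qed

lemma lookup_single_mult:
  fixes p :: "'m::cancel_comm_monoid_add \<Rightarrow>\<^sub>0 'a::comm_semiring_1"
  shows "lookup (single t c * p) (t + u) = c * lookup p u"
proof -
  have "single t c * p = (\<Sum>v\<in>keys p. single (t + v) (c * lookup p v))"
    using arg_cong[OF single_sum_keys[of p], of "\<lambda>q. single t c * q"]
    by (simp add: sum_distrib_left mult_single)
  hence "lookup (single t c * p) (t + u) = (\<Sum>v\<in>keys p. if v = u then c * lookup p u else 0)"
    unfolding lookup_sum by (auto simp: lookup_sum lookup_single when_def intro!: sum.cong)
  thus ?thesis by (simp add: in_keys_iff)
qed

text \<open>The powers of the two variables form a regular sequence.\<close>

lemma xpow_dvd_if_mult_eq:
  fixes p q :: "'k::comm_ring_1 bpoly"
  assumes "b \<noteq> b'" "xpow b' N * p = xpow b N * q"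
  shows "\<exists>e. p = xpow b N * e"
proof -
  have "N \<le> lookup \<tau> b" if "\<tau> \<in> keys p" for \<tau>
  proof -
    have "lookup (xpow b' N * p) (single b' N + \<tau>) = lookup p \<tau>"
      using lookup_single_mult[of "single b' N" 1 p \<tau>] by (simp add: xpow_def)
    hence "single b' N + \<tau> \<in> keys (xpow b N * q)"
      using that assms(2) by (simp add: in_keys_iff)
    then obtain u where "single b' N + \<tau> = single b N + u"
      using keys_mult[of "xpow b N" q] by (auto simp: xpow_def)
    from arg_cong[OF this, of "\<lambda>t. lookup t b"] assms(1) show ?thesis
      by (simp add: lookup_add lookup_single when_def)
  qed
  hence "(\<Sum>\<tau>\<in>keys p. single \<tau> (lookup p \<tau>)) = (\<Sum>\<tau>\<in>keys p. xpow b N * single (\<tau> - single b N) (lookup p \<tau>))"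
    by (intro sum.cong) (auto intro: single_eq_xpow_mult)
  also have "\<dots> = xpow b N * (\<Sum>\<tau>\<in>keys p. single (\<tau> - single b N) (lookup p \<tau>))"
    by (rule sum_distrib_left[symmetric])
  finally show ?thesis unfolding single_sum_keys[of p, symmetric] ..
qed

section \<open>Syzygies of forms and local splitting\<close>

lemma bool_monomial_eqI:
  assumes "lookup t b = lookup u b" "lookup t (\<not> b) = lookup u (\<not> b)" shows "t = u"
proof (rule poly_mapping_eqI)
  fix k show "lookup t k = lookup u k" using assms by (cases "k = b") auto
qed

text \<open>Homogeneous division with remainder, where \<open>ydeg\<close> is the degree in the variable other than \<open>x\<^sub>b\<close>. The
  exponent of that variable determines the monomials of a form of given degree, so after
  multiplication by a power of \<open>x\<^sub>b\<close> a multiple of \<open>g\<close> cancels the leading monomial of \<open>p\<close>. A nonzero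
  remainder would have smaller \<open>ydeg\<close> than \<open>g\<close>, against the choice of \<open>g\<close>.\<close>

lemma form_division:
  fixes g :: "'k::field bpoly" and b :: bool
  defines "ydeg \<equiv> \<lambda>p :: 'k bpoly. Max ((\<lambda>\<tau>. lookup \<tau> (\<not> b)) ` keys p)"
  assumes I_diff: "\<And>p q. p \<in> I \<Longrightarrow> q \<in> I \<Longrightarrow> p - q \<in> I"
    and I_mult: "\<And>r p. p \<in> I \<Longrightarrow> r * p \<in> I"
    and g: "g \<in> I" "g \<noteq> 0" "form eg g"
    and min: "\<And>p e. p \<in> I \<Longrightarrow> p \<noteq> 0 \<Longrightarrow> form e p \<Longrightarrow> ydeg g \<le> ydeg p"
  shows "p \<in> I \<Longrightarrow> form e p \<Longrightarrow> \<exists>c q. xpow b c * p = q * g"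
proof (induction "ydeg p" arbitrary: p e rule: less_induct)
  case less
  have xdeg_b: "xdeg \<tau> = lookup \<tau> b + lookup \<tau> (\<not> b)" for \<tau>
    by (cases b) (simp_all add: xdeg_def UNIV_bool)
  have lead: "\<exists>\<tau>\<in>keys p. lookup \<tau> (\<not> b) = ydeg p \<and> (\<forall>\<tau>'\<in>keys p. lookup \<tau>' (\<not> b) \<le> ydeg p)"
    if "p \<noteq> 0" for p
  proof -
    have "ydeg p \<in> (\<lambda>\<tau>. lookup \<tau> (\<not> b)) ` keys p"
      unfolding ydeg_def using that by (intro Max_in) auto
    thus ?thesis by (auto simp: ydeg_def)
  qed
  show ?case
  proof (cases "p = 0")
    case True
    thus ?thesis by (intro exI[of _ 0]) auto
  next
    case False
    obtain \<tau> where \<tau>: "\<tau> \<in> keys p" "lookup \<tau> (\<not> b) = ydeg p" and p_le: "\<And>t. t \<in> keys p \<Longrightarrow> lookup t (\<not> b) \<le> ydeg p"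
      using lead[OF False] by blast
    obtain \<upsilon> where \<upsilon>: "\<upsilon> \<in> keys g" "lookup \<upsilon> (\<not> b) = ydeg g" and g_le: "\<And>t. t \<in> keys g \<Longrightarrow> lookup t (\<not> b) \<le> ydeg g"
      using lead[OF g(2)] by blast
    have le: "ydeg g \<le> ydeg p" by (rule min[OF less.prems(1) False less.prems(2)])
    define a a' where "a = lookup \<tau> b" and "a' = lookup \<upsilon> b"
    define t where "t = single b a + single (\<not> b) (ydeg p - ydeg g)"
    have shift: "single b a' + \<tau> = t + \<upsilon>"
      using le \<tau>(2) \<upsilon>(2)
      by (intro bool_monomial_eqI[of _ b]) (simp_all add: t_def a_def a'_def lookup_add lookup_single when_def)
    define p' where "p' = xpow b a' * p - single t (lookup p \<tau> / lookup g \<upsilon>) * g"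
    have e: "e = int (xdeg \<tau>)" "eg = int (xdeg \<upsilon>)"
      using less.prems(2) g(3) \<tau>(1) \<upsilon>(1) by (simp_all add: form_iff_xdeg)
    have "int a' + e = int (xdeg t) + eg"
      using arg_cong[OF shift, of xdeg] by (simp add: e)
    hence form_p': "form (int a' + e) p'"
      unfolding p'_def using form_mult[OF form_xpow less.prems(2), of a' b]
        form_mult[OF form_single g(3), of t "lookup p \<tau> / lookup g \<upsilon>"]
      by (intro form_diff) simp_all
    have p'_I: "p' \<in> I" unfolding p'_def by (intro I_diff I_mult less.prems g)
    have coeff: "lookup p' (single b a' + \<tau>) = 0"
      using \<upsilon>(1) lookup_single_mult[of "single b a'" 1 p \<tau>] lookup_single_mult[of t "lookup p \<tau> / lookup g \<upsilon>" g \<upsilon>]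
      by (simp add: p'_def lookup_minus xpow_def in_keys_iff flip: shift)
    have "\<exists>c q. xpow b c * p' = q * g"
    proof (cases "p' = 0")
      case True
      thus ?thesis by (intro exI[of _ 0]) auto
    next
      case nz: False
      obtain u where u: "u \<in> keys p'" "lookup u (\<not> b) = ydeg p'" using lead[OF nz] by blast
      have "u \<in> keys (xpow b a' * p) \<or> u \<in> keys (single t (lookup p \<tau> / lookup g \<upsilon>) * g)"
        using u(1) keys_diff[of "xpow b a' * p" "single t (lookup p \<tau> / lookup g \<upsilon>) * g"]
        unfolding p'_def by blast
      hence "lookup u (\<not> b) \<le> ydeg p"
      proof
        assume "u \<in> keys (xpow b a' * p)"
        with keys_mult[of "xpow b a'" p] obtain v where "v \<in> keys p" "u = single b a' + v"
          by (auto simp: xpow_def)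
        thus ?thesis using p_le[of v] by (simp add: lookup_add lookup_single when_def)
      next
        assume "u \<in> keys (single t (lookup p \<tau> / lookup g \<upsilon>) * g)"
        with keys_mult[of "single t (lookup p \<tau> / lookup g \<upsilon>)" g] obtain v where "v \<in> keys g" "u = t + v"
          by (auto split: if_splits)
        thus ?thesis using g_le[of v] le by (simp add: t_def lookup_add lookup_single when_def)
      qed
      moreover have "lookup u (\<not> b) \<noteq> ydeg p"
      proof
        assume *: "lookup u (\<not> b) = ydeg p"
        have "int (xdeg u) = int a' + e" using form_p' u(1) by (simp add: form_iff_xdeg)
        hence "xdeg u = a' + xdeg \<tau>" using e by simp
        hence "lookup u b = a' + lookup \<tau> b" using * \<tau>(2) by (simp add: xdeg_b)
        hence "u = single b a' + \<tau>" using * \<tau>(2)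
          by (intro bool_monomial_eqI[of _ b]) (simp_all add: lookup_add lookup_single when_def)
        thus False using coeff u(1) by (simp add: in_keys_iff)
      qed
      ultimately have "ydeg p' < ydeg p" using u(2) by simp
      from less.hyps[OF this p'_I form_p'] show ?thesis .
    qed
    then obtain c q where "xpow b c * p' = q * g" by blast
    hence "xpow b (c + a') * p = (q + xpow b c * single t (lookup p \<tau> / lookup g \<upsilon>)) * g"
      by (simp add: p'_def xpow_add algebra_simps)
    thus ?thesis by blast
  qed
qed

text \<open>Setting \<open>x\<^sub>b = 1\<close>, let \<open>g\<close> be the greatest common divisor of the \<open>f j\<close> and \<open>q j\<close> the quotients. They have
  the same syzygies as the \<open>f j\<close>, and the expression of \<open>g\<close> by the \<open>f j\<close> becomes one of \<open>1\<close> by the \<open>q j\<close>.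
  The statement is the homogeneous form of this; \<open>g\<close> is found as a form in the ideal that has the least
  degree in the other variable.\<close>

lemma same_syzygies_with_xpow_combination:
  fixes f :: "nat \<Rightarrow> 'k::field bpoly" and b :: bool
  assumes f: "\<And>j. j < n \<Longrightarrow> form e (f j)" and nz: "\<exists>j<n. f j \<noteq> 0"
  shows "\<exists>c h q. (\<Sum>j<n. h j * q j) = xpow b c \<and>
    (\<forall>a. (\<Sum>j<n. a j * q j) = 0 \<longleftrightarrow> (\<Sum>j<n. a j * f j) = 0)"
proof -
  define ydeg where "ydeg p = Max ((\<lambda>\<tau>. lookup \<tau> (\<not> b)) ` keys p)" for p :: "'k bpoly"
  define I where "I = {p. \<exists>h. p = (\<Sum>j<n. h j * f j)}"
  have I_diff: "p - q \<in> I" if "p \<in> I" "q \<in> I" for p q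
  proof -
    obtain h h' where "p = (\<Sum>j<n. h j * f j)" "q = (\<Sum>j<n. h' j * f j)" using \<open>p \<in> I\<close> \<open>q \<in> I\<close> unfolding I_def by blast
    hence "p - q = (\<Sum>j<n. (h j - h' j) * f j)" by (simp add: left_diff_distrib sum_subtractf)
    thus ?thesis unfolding I_def by (intro CollectI exI[of _ "\<lambda>j. h j - h' j"])
  qed
  have I_mult: "r * p \<in> I" if "p \<in> I" for r p
  proof -
    obtain h where "p = (\<Sum>j<n. h j * f j)" using \<open>p \<in> I\<close> unfolding I_def by blast
    hence "r * p = (\<Sum>j<n. (r * h j) * f j)" by (simp add: sum_distrib_left mult.assoc)
    thus ?thesis unfolding I_def by (intro CollectI exI[of _ "\<lambda>j. r * h j"])
  qed
  have f_I: "f j \<in> I" if "j < n" for j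
  proof -
    have "(\<Sum>l<n. (if l = j then 1 else 0) * f l) = (\<Sum>l<n. if l = j then f j else 0)"
      by (rule sum.cong) auto
    hence "f j = (\<Sum>l<n. (if l = j then 1 else 0) * f l)" using that by simp
    thus ?thesis unfolding I_def by (intro CollectI exI[of _ "\<lambda>l. if l = j then 1 else 0"])
  qed
  define P where "P p \<longleftrightarrow> p \<in> I \<and> p \<noteq> 0 \<and> (\<exists>e. form e p)" for p
  obtain j0 where "P (f j0)" using nz f f_I by (auto simp: P_def)
  then obtain g where g: "P g" "\<And>p. P p \<Longrightarrow> ydeg g \<le> ydeg p"
    using ex_has_least_nat[of P _ ydeg] by blast
  obtain eg where g': "g \<in> I" "g \<noteq> 0" "form eg g" using g(1) by (auto simp: P_def)
  have "\<exists>c q. xpow b c * f j = q * g" if "j < n" for j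
    using f_I[OF that] f[OF that]
  proof (rule form_division[where I = I, rotated -2])
    show "Max ((\<lambda>\<tau>. lookup \<tau> (\<not> b)) ` keys g) \<le> Max ((\<lambda>\<tau>. lookup \<tau> (\<not> b)) ` keys p)"
      if "p \<in> I" "p \<noteq> 0" "form e p" for p e
      using g(2)[of p] that unfolding P_def ydeg_def by blast
  qed (fact I_diff I_mult g')+
  hence "\<forall>j. \<exists>x. j < n \<longrightarrow> xpow b (fst x) * f j = snd x * g" by auto
  from choice[OF this] obtain x where x: "\<forall>j. j < n \<longrightarrow> xpow b (fst (x j)) * f j = snd (x j) * g" ..
  define c q where "c j = fst (x j)" and "q j = snd (x j)" for j
  have cq: "xpow b (c j) * f j = q j * g" if "j < n" for j using x that by (simp add: c_def q_def)
  define C where "C = (\<Sum>j<n. c j)"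
  define q' where "q' j = xpow b (C - c j) * q j" for j
  have q': "xpow b C * f j = q' j * g" if "j < n" for j
  proof -
    have "c j \<le> C" unfolding C_def using that by (intro member_le_sum) auto
    hence "xpow b C = xpow b (C - c j) * (xpow b (c j) :: 'k bpoly)" by (simp flip: xpow_add)
    thus ?thesis using cq[OF that] by (simp add: q'_def mult.assoc)
  qed
  have sums: "(\<Sum>j<n. a j * q' j) * g = xpow b C * (\<Sum>j<n. a j * f j)" for a
    unfolding sum_distrib_left sum_distrib_right
    by (rule sum.cong) (simp_all add: mult.assoc mult.left_commute q'[symmetric])
  obtain h where h: "g = (\<Sum>j<n. h j * f j)" using g'(1) by (auto simp: I_def)
  have "(\<Sum>j<n. h j * q' j) * g = xpow b C * g" unfolding sums h[symmetric] ..
  hence "(\<Sum>j<n. h j * q' j) = xpow b C" using g'(2) by simp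
  moreover have "(\<Sum>j<n. a j * q' j) = 0 \<longleftrightarrow> (\<Sum>j<n. a j * f j) = 0" for a
  proof -
    have "(\<Sum>j<n. a j * q' j) * g = 0 \<longleftrightarrow> xpow b C * (\<Sum>j<n. a j * f j) = 0" by (simp only: sums)
    thus ?thesis using g'(2) by (simp only: mult_eq_0_iff xpow_nonzero simp_thms)
  qed
  ultimately show ?thesis by blast
qed

text \<open>With \<open>h\<close> and \<open>q\<close> as in the preceding lemma, \<open>x\<^sub>b\<^sup>c a - (q \<cdot> a) h\<close> is a syzygy for every vector \<open>a\<close>, so it has
  a preimage under \<open>\<phi>\<close>. The preimages for the standard basis vectors are the columns of \<open>\<psi>\<close>. Since \<open>q\<close>
  annihilates the columns of \<open>\<phi>\<close>, it follows that \<open>\<phi> \<psi> \<phi> = x\<^sub>b\<^sup>c \<phi>\<close>, and \<open>\<phi>\<close> is injective. In the language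
  of sheaves: the cokernel of any set of columns of \<open>\<phi>\<close> is locally free where \<open>x\<^sub>b\<close> does not vanish.\<close>

lemma hilbert_burch_local_splitting:
  fixes f :: "nat \<Rightarrow> 'k::field bpoly"
  assumes f: "\<And>j. j < n \<Longrightarrow> form e (f j)" and nz: "\<exists>j<n. f j \<noteq> 0"
    and res: "hilbert_burch_resolution n f \<delta> \<phi>"
  shows "\<exists>N \<psi>. \<forall>i<n - 1. \<forall>i'<n - 1. (\<Sum>l<n. \<psi> i l * \<phi> l i') = (if i = i' then xpow b N else 0)"
proof -
  define G where "G = {v :: nat \<Rightarrow> 'k bpoly. \<forall>i\<ge>n - 1. v i = 0}"
  have inj: "inj_on (mat_map n (n - 1) \<phi>) G"
    and exact: "mat_map n (n - 1) \<phi> ` G = {a. (\<forall>i\<ge>n. a i = 0) \<and> (\<Sum>j<n. a j * f j) = 0}"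
    using res by (simp_all add: hilbert_burch_resolution_def Let_def free_module_def G_def)
  obtain c h q where h: "(\<Sum>j<n. h j * q j) = xpow b c"
    and syz: "\<And>a. (\<Sum>j<n. a j * q j) = 0 \<longleftrightarrow> (\<Sum>j<n. a j * f j) = 0"
    using same_syzygies_with_xpow_combination[OF f nz, of b] by blast
  have "\<exists>v\<in>G. mat_map n (n - 1) \<phi> v = (\<lambda>j. if j < n then (if j = l then xpow b c else 0) - q l * h j else 0)"
    (is "\<exists>v\<in>G. _ = ?u") if l: "l < n" for l
  proof -
    have "(\<Sum>j<n. ?u j * q j) = (\<Sum>j<n. if j = l then xpow b c * q l else 0) - q l * (\<Sum>j<n. h j * q j)"
      unfolding sum_distrib_left sum_subtractf[symmetric] by (rule sum.cong) (auto simp: algebra_simps)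
    hence "(\<Sum>j<n. ?u j * q j) = 0" using l by (simp add: h)
    hence "(\<Sum>j<n. ?u j * f j) = 0" by (rule syz[THEN iffD1])
    hence "?u \<in> mat_map n (n - 1) \<phi> ` G" unfolding exact by auto
    then obtain v where "?u = mat_map n (n - 1) \<phi> v" "v \<in> G" by (rule imageE)
    thus ?thesis by (intro bexI[of _ v]) simp_all
  qed
  hence "\<forall>l. \<exists>v. l < n \<longrightarrow> v \<in> G \<and> mat_map n (n - 1) \<phi> v = (\<lambda>j. if j < n then (if j = l then xpow b c else 0) - q l * h j else 0)"
    by blast
  from choice[OF this] obtain v where v: "\<And>l. l < n \<Longrightarrow> v l \<in> G"
    "\<And>l. l < n \<Longrightarrow> mat_map n (n - 1) \<phi> (v l) = (\<lambda>j. if j < n then (if j = l then xpow b c else 0) - q l * h j else 0)"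
    by blast
  have "(\<Sum>l<n. v l i * \<phi> l i') = (if i = i' then xpow b c else 0)" if i: "i < n - 1" "i' < n - 1" for i i'
  proof -
    \<comment> \<open>Columns with the index \<open>i'\<close> of \<open>\<psi> \<phi>\<close> and of the scalar matrix.\<close>
    define u where "u = (\<lambda>i. \<Sum>l<n. v l i * \<phi> l i')"
    define u' where "u' = (\<lambda>i. if i = i' then xpow b c else 0 :: 'k bpoly)"
    have "mat_map n (n - 1) \<phi> u = mat_map n (n - 1) \<phi> u'"
    proof
      fix j
      show "mat_map n (n - 1) \<phi> u j = mat_map n (n - 1) \<phi> u' j"
      proof (cases "j < n")
        case j: True
        have unit: "(\<lambda>i. if i = i' then 1 else 0 :: 'k bpoly) \<in> G" using i by (auto simp: G_def)
        have "mat_map n (n - 1) \<phi> (\<lambda>i. if i = i' then 1 else 0) = (\<lambda>l. if l < n then \<phi> l i' else 0)"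
          using i by (auto simp: mat_map_def if_distrib cong: if_cong)
        hence "(\<lambda>l. if l < n then \<phi> l i' else 0) \<in> mat_map n (n - 1) \<phi> ` G"
          by (intro image_eqI[OF _ unit]) simp
        hence "(\<Sum>l<n. (if l < n then \<phi> l i' else 0) * f l) = 0" unfolding exact by simp
        hence "(\<Sum>l<n. (if l < n then \<phi> l i' else 0) * q l) = 0" by (rule syz[THEN iffD2])
        moreover have "(\<Sum>l<n. (if l < n then \<phi> l i' else 0) * q l) = (\<Sum>l<n. \<phi> l i' * q l)"
          by (rule sum.cong) simp_all
        ultimately have \<phi>q: "(\<Sum>l<n. \<phi> l i' * q l) = 0" by simp
        have "mat_map n (n - 1) \<phi> u j = (\<Sum>i<n-1. \<Sum>l<n. \<phi> j i * (v l i * \<phi> l i'))"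
          using j by (simp add: mat_map_def u_def sum_distrib_left)
        also have "\<dots> = (\<Sum>l<n. \<Sum>i<n-1. \<phi> j i * (v l i * \<phi> l i'))" by (rule sum.swap)
        also have "\<dots> = (\<Sum>l<n. mat_map n (n - 1) \<phi> (v l) j * \<phi> l i')"
          using j by (simp add: mat_map_def sum_distrib_right mult.assoc)
        also have "\<dots> = (\<Sum>l<n. (if l = j then xpow b c * \<phi> j i' else 0)) - h j * (\<Sum>l<n. \<phi> l i' * q l)"
          unfolding sum_distrib_left sum_subtractf[symmetric]
          by (rule sum.cong) (use v(2) j in \<open>auto simp: algebra_simps\<close>)
        also have "\<dots> = xpow b c * \<phi> j i'" using j by (simp add: \<phi>q)
        also have "\<dots> = mat_map n (n - 1) \<phi> u' j"
          using i j by (simp add: mat_map_def u'_def if_distrib mult.commute cong: if_cong)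
        finally show ?thesis .
      qed (simp add: mat_map_def)
    qed
    moreover have "u \<in> G" using v(1) by (auto simp: G_def u_def intro!: sum.neutral)
    moreover have "u' \<in> G" using i by (auto simp: G_def u'_def)
    ultimately have "u = u'" using inj by (auto dest: inj_onD)
    thus ?thesis by (simp add: u_def u'_def fun_eq_iff)
  qed
  thus ?thesis by (intro exI[of _ c] exI[of _ "\<lambda>i l. v l i"]) blast
qed

section \<open>The embedding of the module in its bidual\<close>

text \<open>The elements of \<open>R\<^sup>n\<close>, encoded as in \<^const>\<open>free_module\<close>.\<close>

definition coord :: "nat \<Rightarrow> (nat \<Rightarrow> 'r::zero) set" where
  "coord n = {v. \<forall>i\<ge>n. v i = 0}"

abbreviation (input) basis_vec :: "nat \<Rightarrow> nat \<Rightarrow> 'r::zero_neq_one" where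
  "basis_vec j \<equiv> \<lambda>i. if i = j then 1 else 0"

lemma mat_map_add: "mat_map n m \<phi> (a + b) = mat_map n m \<phi> a + mat_map n m \<phi> b"
  by (auto simp: mat_map_def fun_eq_iff sum.distrib algebra_simps)

lemma mat_map_smult: "mat_map n m \<phi> (\<lambda>i. r * a i) = (\<lambda>j. r * mat_map n m \<phi> a j)"
  by (auto simp: mat_map_def fun_eq_iff sum_distrib_left mult.left_commute)

lemma linear_on_coord:
  fixes h :: "(nat \<Rightarrow> 'r::comm_ring_1) \<Rightarrow> 'r"
  assumes add: "\<And>a b. a \<in> coord n \<Longrightarrow> b \<in> coord n \<Longrightarrow> h (a + b) = h a + h b"
    and smult: "\<And>r a. a \<in> coord n \<Longrightarrow> h (\<lambda>i. r * a i) = r * h a"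
    and a: "a \<in> coord n"
  shows "h a = (\<Sum>j<n. a j * h (basis_vec j))"
proof -
  have "h (\<lambda>i. if i < k then a i else 0) = (\<Sum>j<k. a j * h (basis_vec j))" if "k \<le> n" for k
    using that
  proof (induction k)
    case 0
    have "h (\<lambda>i. 0 * (0 :: nat \<Rightarrow> 'r) i) = 0 * h 0" by (rule smult) (simp add: coord_def)
    thus ?case by simp
  next
    case (Suc k)
    have "(\<lambda>i. if i < Suc k then a i else 0) = (\<lambda>i. if i < k then a i else 0) + (\<lambda>i. a k * basis_vec k i)"
      by (auto simp: fun_eq_iff less_Suc_eq)
    moreover have "(\<lambda>i. if i < k then a i else 0) \<in> coord n" "(\<lambda>i. a k * basis_vec k i) \<in> coord n"
      using Suc.prems by (auto simp: coord_def)
    ultimately have "h (\<lambda>i. if i < Suc k then a i else 0) =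
        h (\<lambda>i. if i < k then a i else 0) + h (\<lambda>i. a k * basis_vec k i)" by (simp only: add)
    also have "h (\<lambda>i. a k * basis_vec k i) = a k * h (basis_vec k)"
      using Suc.prems by (intro smult) (auto simp: coord_def)
    finally show ?case using Suc by simp
  qed
  from this[of n] have "h (\<lambda>i. if i < n then a i else 0) = (\<Sum>j<n. a j * h (basis_vec j))" by simp
  moreover have "(\<lambda>i. if i < n then a i else 0) = a" using a by (auto simp: coord_def fun_eq_iff)
  ultimately show ?thesis by (simp only:)
qed

context
  fixes n m s :: nat and \<phi> :: "nat \<Rightarrow> nat \<Rightarrow> 'k::field bpoly" and \<sigma> :: "nat \<Rightarrow> nat"
    and \<Theta> :: "(((nat \<Rightarrow> 'k bpoly) set \<Rightarrow> 'k bpoly) \<Rightarrow> 'k bpoly) \<Rightarrow> nat \<Rightarrow> 'k bpoly"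
  assumes iso: "graded_iso (dual (dual (E_module n m \<phi>))) (free_module s (\<lambda>i. int (\<sigma> i))) \<Theta>"
begin

private definition U :: "(nat \<Rightarrow> 'k bpoly) set" where
  "U = mat_map n m \<phi> ` coord m"

text \<open>The cokernel of the first \<open>m\<close> columns of \<open>\<phi>\<close> is handled through representatives.\<close>

private definition cls :: "(nat \<Rightarrow> 'k bpoly) \<Rightarrow> (nat \<Rightarrow> 'k bpoly) set" where
  "cls a = (\<lambda>u. u + a) ` U"

private abbreviation (input) "Q \<equiv> E_module n m \<phi>"

text \<open>The composite of \<open>R\<^sup>n \<rightarrow> E\<close>, of the evaluation map into the bidual and of its given isomorphism \<open>\<Theta>\<close>
  with a free module.\<close>

definition iota :: "(nat \<Rightarrow> 'k bpoly) \<Rightarrow> nat \<Rightarrow> 'k bpoly" where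
  "iota a = \<Theta> (bidual_eval Q (cls a))"

private lemma U_0: "0 \<in> U"
  unfolding U_def by (rule image_eqI[of _ _ 0]) (auto simp: mat_map_def fun_eq_iff coord_def)

private lemma U_add: "u \<in> U \<Longrightarrow> v \<in> U \<Longrightarrow> u + v \<in> U"
  unfolding U_def
proof (elim imageE)
  fix a b assume "u = mat_map n m \<phi> a" "v = mat_map n m \<phi> b" "a \<in> coord m" "b \<in> coord m"
  thus "u + v \<in> mat_map n m \<phi> ` coord m"
    by (intro image_eqI[of _ _ "a + b"]) (simp_all add: mat_map_add coord_def)
qed

private lemma U_smult: "u \<in> U \<Longrightarrow> (\<lambda>j. r * u j) \<in> U"
  unfolding U_def
proof (elim imageE)
  fix a assume "u = mat_map n m \<phi> a" "a \<in> coord m"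
  thus "(\<lambda>j. r * u j) \<in> mat_map n m \<phi> ` coord m"
    by (intro image_eqI[of _ _ "\<lambda>i. r * a i"]) (simp_all add: mat_map_smult coord_def)
qed

private lemma U_minus: "u \<in> U \<Longrightarrow> - u \<in> U"
  using U_smult[of u "-1"] by (simp add: fun_Compl_def)

private lemma cls_eq: "u \<in> U \<Longrightarrow> cls (u + a) = cls a"
proof -
  assume u: "u \<in> U"
  have "v + (u + a) \<in> cls a" if "v \<in> U" for v
    unfolding cls_def using U_add[OF that u] by (intro image_eqI[of _ _ "v + u"]) (simp_all add: add.assoc)
  moreover have "v + a \<in> cls (u + a)" if "v \<in> U" for v
    unfolding cls_def using U_add[OF that U_minus[OF u]]
    by (intro image_eqI[of _ _ "v + - u"]) (simp_all add: add.assoc)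
  ultimately show ?thesis by (auto simp: cls_def)
qed

private lemma self_in_cls: "a \<in> cls a"
  unfolding cls_def using U_0 by (intro image_eqI[of _ _ 0]) simp_all

private lemma a_r_coset_eq: "U +>\<^bsub>free_module n (\<lambda>j. 0)\<^esub> a = cls a"
  by (auto simp: a_r_coset_def r_coset_def free_module_def cls_def)

private lemma E_module_eq: "Q = quotient_module (free_module n (\<lambda>j. 0)) U"
  by (simp add: E_module_def U_def free_module_def coord_def)

private lemma carrier_Q: "carrier Q = cls ` coord n"
proof -
  have "carrier (free_module n (\<lambda>j. 0) :: ('k bpoly, nat \<Rightarrow> 'k bpoly) graded_module) = coord n"
    by (simp add: free_module_def coord_def)
  thus ?thesis unfolding E_module_eq quotient_module_def
    by (auto simp: A_RCOSETS_def' a_r_coset_eq)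
qed

private lemma add_Q: "cls a \<oplus>\<^bsub>Q\<^esub> cls b = cls (a + b)"
proof -
  have "cls a \<oplus>\<^bsub>Q\<^esub> cls b = {x + y |x y. x \<in> cls a \<and> y \<in> cls b}"
    unfolding E_module_eq quotient_module_def by (auto simp: set_add_def set_mult_def free_module_def)
  also have "\<dots> = cls (a + b)"
  proof (intro equalityI subsetI)
    fix z assume "z \<in> {x + y |x y. x \<in> cls a \<and> y \<in> cls b}"
    then obtain u v where "u \<in> U" "v \<in> U" "z = u + a + (v + b)" by (auto simp: cls_def)
    thus "z \<in> cls (a + b)" unfolding cls_def
      by (intro image_eqI[of _ _ "u + v"]) (auto simp: ac_simps intro: U_add)
  next
    fix z assume "z \<in> cls (a + b)"
    then obtain u where "u \<in> U" "z = (u + a) + b" by (auto simp: cls_def ac_simps)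
    thus "z \<in> {x + y |x y. x \<in> cls a \<and> y \<in> cls b}" using self_in_cls[of b] by (auto simp: cls_def)
  qed
  finally show ?thesis .
qed

private lemma smult_Q: "r \<odot>\<^bsub>Q\<^esub> cls a = cls (\<lambda>i. r * a i)"
proof -
  have "r \<odot>\<^bsub>Q\<^esub> cls a = (\<Union>x\<in>cls a. cls (\<lambda>i. r * x i))"
    unfolding E_module_eq quotient_module_def by (simp add: a_r_coset_eq) (simp add: free_module_def)
  also have "\<dots> = (\<Union>x\<in>cls a. cls (\<lambda>i. r * a i))"
  proof (rule SUP_cong)
    fix x assume "x \<in> cls a"
    then obtain u where u: "u \<in> U" "x = u + a" by (auto simp: cls_def)
    hence "(\<lambda>i. r * x i) = (\<lambda>i. r * u i) + (\<lambda>i. r * a i)" by (auto simp: fun_eq_iff algebra_simps)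
    thus "cls (\<lambda>i. r * x i) = cls (\<lambda>i. r * a i)" using cls_eq[OF U_smult[OF u(1)]] by simp
  qed simp
  also have "\<dots> = cls (\<lambda>i. r * a i)" using self_in_cls[of a] by blast
  finally show ?thesis .
qed

private lemma gr_Q: "a \<in> coord n \<Longrightarrow> (\<And>j. j < n \<Longrightarrow> form e (a j)) \<Longrightarrow> cls a \<in> gr Q e"
  unfolding E_module_eq quotient_module_def by (auto simp: a_r_coset_eq) (auto simp: free_module_def coord_def)

private lemma carrier_dual_Q:
  "g \<in> carrier (dual Q) \<longleftrightarrow> g \<in> extensional (cls ` coord n) \<and>
    (\<forall>a\<in>coord n. \<forall>b\<in>coord n. g (cls (a + b)) = g (cls a) + g (cls b)) \<and>
    (\<forall>r. \<forall>a\<in>coord n. g (cls (\<lambda>i. r * a i)) = r * g (cls a))"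
  by (auto simp: dual_def linear_map_def carrier_Q base_module_def add_Q smult_Q)

private lemma functional_coord:
  assumes "g \<in> carrier (dual Q)" "a \<in> coord n"
  shows "g (cls a) = (\<Sum>j<n. a j * g (cls (basis_vec j)))"
  using assms by (intro linear_on_coord[where h = "\<lambda>a. g (cls a)"]) (simp_all add: carrier_dual_Q)

private lemma dot_U:
  assumes "\<And>i. i < m \<Longrightarrow> (\<Sum>j<n. \<gamma> j * \<phi> j i) = 0" "u \<in> U"
  shows "(\<Sum>j<n. \<gamma> j * u j) = 0"
proof -
  obtain c where "u = mat_map n m \<phi> c" using assms(2) by (auto simp: U_def)
  hence "(\<Sum>j<n. \<gamma> j * u j) = (\<Sum>j<n. \<Sum>i<m. \<gamma> j * \<phi> j i * c i)"
    by (simp add: mat_map_def sum_distrib_left mult.assoc)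
  also have "\<dots> = (\<Sum>i<m. \<Sum>j<n. \<gamma> j * \<phi> j i * c i)" by (rule sum.swap)
  also have "\<dots> = (\<Sum>i<m. (\<Sum>j<n. \<gamma> j * \<phi> j i) * c i)" by (simp add: sum_distrib_right)
  also have "\<dots> = 0" using assms(1) by simp
  finally show ?thesis .
qed

text \<open>A covector that annihilates the columns of \<open>\<phi>\<close> takes the same value on all representatives of a
  class.\<close>

private lemma functional_of_covector:
  assumes \<gamma>: "\<And>i. i < m \<Longrightarrow> (\<Sum>j<n. \<gamma> j * \<phi> j i) = 0"
  shows "\<exists>g\<in>carrier (dual Q). \<forall>a\<in>coord n. g (cls a) = (\<Sum>j<n. \<gamma> j * a j)"
proof -
  define g where "g = (\<lambda>C\<in>cls ` coord n. \<Sum>j<n. \<gamma> j * (SOME a. a \<in> C) j)"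
  have g: "g (cls a) = (\<Sum>j<n. \<gamma> j * a j)" if "a \<in> coord n" for a
  proof -
    have "(SOME b. b \<in> cls a) \<in> cls a" using self_in_cls[of a] by (rule someI[of "\<lambda>b. b \<in> cls a"])
    then obtain u where u: "u \<in> U" "(SOME b. b \<in> cls a) = u + a" by (auto simp: cls_def)
    have "g (cls a) = (\<Sum>j<n. \<gamma> j * u j) + (\<Sum>j<n. \<gamma> j * a j)"
      using that by (simp add: g_def u(2) distrib_left sum.distrib)
    thus ?thesis using dot_U[OF \<gamma> u(1)] by simp
  qed
  have coord: "a + b \<in> coord n" "(\<lambda>i. r * a i) \<in> coord n" if "a \<in> coord n" "b \<in> coord n" for a b :: "nat \<Rightarrow> 'k bpoly" and r
    using that by (auto simp: coord_def)
  have "g \<in> carrier (dual Q)"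
    unfolding carrier_dual_Q
  proof (intro conjI ballI allI)
    show "g \<in> extensional (cls ` coord n)" by (simp add: g_def)
    fix a :: "nat \<Rightarrow> 'k bpoly" assume a: "a \<in> coord n"
    show "g (cls (a + b)) = g (cls a) + g (cls b)" if b: "b \<in> coord n" for b
      by (simp add: g[OF a] g[OF b] g[OF coord(1)[OF a b]] distrib_left sum.distrib)
    show "g (cls (\<lambda>i. r * a i)) = r * g (cls a)" for r
      by (simp add: g[OF a] g[OF coord(2)[OF a a]] sum_distrib_left mult.left_commute)
  qed
  thus ?thesis using g by (intro bexI[of _ g] ballI)
qed

private abbreviation (input) "D \<equiv> dual (dual Q)"

private lemma carrier_D:
  "\<xi> \<in> carrier D \<longleftrightarrow> \<xi> \<in> extensional (carrier (dual Q)) \<and> linear_map (dual Q) base_module \<xi>"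
  by (simp add: dual_def[of "dual Q"])

private lemma add_D: "\<xi> \<oplus>\<^bsub>D\<^esub> \<eta> = (\<lambda>g\<in>carrier (dual Q). \<xi> g + \<eta> g)"
  by (simp add: dual_def[of "dual Q"])

private lemma smult_D: "r \<odot>\<^bsub>D\<^esub> \<xi> = (\<lambda>g\<in>carrier (dual Q). r * \<xi> g)"
  by (simp add: dual_def[of "dual Q"])

private lemma dual_Q_add: "g \<oplus>\<^bsub>dual Q\<^esub> h = (\<lambda>x\<in>cls ` coord n. g x + h x)"
  by (simp add: dual_def carrier_Q)

private lemma dual_Q_smult: "r \<odot>\<^bsub>dual Q\<^esub> g = (\<lambda>x\<in>cls ` coord n. r * g x)"
  by (simp add: dual_def carrier_Q)

private lemma dual_Q_add_closed:
  "g \<in> carrier (dual Q) \<Longrightarrow> h \<in> carrier (dual Q) \<Longrightarrow> g \<oplus>\<^bsub>dual Q\<^esub> h \<in> carrier (dual Q)"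
  unfolding carrier_dual_Q dual_Q_add by (auto simp: coord_def algebra_simps)

private lemma dual_Q_smult_closed:
  "g \<in> carrier (dual Q) \<Longrightarrow> r \<odot>\<^bsub>dual Q\<^esub> g \<in> carrier (dual Q)"
  unfolding carrier_dual_Q dual_Q_smult by (auto simp: coord_def algebra_simps)

text \<open>Additivity of \<open>\<xi>\<close> for finite linear combinations; since the dual is a module record, these are
  spelled out pointwise.\<close>

private lemma dual_Q_sum:
  fixes \<gamma> :: "nat \<Rightarrow> 'k bpoly"
  assumes P: "\<And>k. k < K \<Longrightarrow> P k \<in> carrier (dual Q)" and g: "g \<in> carrier (dual Q)" and \<xi>: "\<xi> \<in> carrier D"
  defines "S \<equiv> \<lambda>K. \<lambda>x\<in>cls ` coord n. \<Sum>k<K. \<gamma> k * P k x"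
  shows "S K \<in> carrier (dual Q) \<and> \<xi> (S K) = (\<Sum>k<K. \<gamma> k * \<xi> (P k))"
  using P
proof (induction K)
  case 0
  have "S 0 = 0 \<odot>\<^bsub>dual Q\<^esub> g" by (simp add: S_def dual_Q_smult)
  thus ?case using g \<xi> dual_Q_smult_closed[OF g, of 0]
    by (simp add: carrier_D linear_map_def base_module_def)
next
  case (Suc K)
  have S: "S (Suc K) = S K \<oplus>\<^bsub>dual Q\<^esub> (\<gamma> K \<odot>\<^bsub>dual Q\<^esub> P K)"
    by (auto simp: S_def dual_Q_smult dual_Q_add fun_eq_iff)
  have "P K \<in> carrier (dual Q)" "S K \<in> carrier (dual Q)" "\<xi> (S K) = (\<Sum>k<K. \<gamma> k * \<xi> (P k))"
    using Suc by auto
  thus ?case using \<xi> unfolding S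
    by (simp add: carrier_D linear_map_def base_module_def dual_Q_add_closed dual_Q_smult_closed)
qed

private lemma eval_in_D: "a \<in> coord n \<Longrightarrow> bidual_eval Q (cls a) \<in> carrier D"
  unfolding carrier_D linear_map_def
proof (intro conjI ballI allI)
  assume a: "a \<in> coord n"
  show "bidual_eval Q (cls a) \<in> extensional (carrier (dual Q))" by (simp add: bidual_eval_def)
  show "bidual_eval Q (cls a) \<in> carrier (dual Q) \<rightarrow> carrier base_module" by (simp add: base_module_def)
  fix g assume g: "g \<in> carrier (dual Q)"
  show "bidual_eval Q (cls a) (g \<oplus>\<^bsub>dual Q\<^esub> h) =
      bidual_eval Q (cls a) g \<oplus>\<^bsub>base_module\<^esub> bidual_eval Q (cls a) h" if h: "h \<in> carrier (dual Q)" for h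
  proof -
    have "g \<oplus>\<^bsub>dual Q\<^esub> h \<in> carrier (dual Q)"
      using g h by (rule dual_Q_add_closed)
    thus ?thesis using g h a by (simp add: bidual_eval_def base_module_def) (simp add: dual_Q_add)
  qed
  show "bidual_eval Q (cls a) (r \<odot>\<^bsub>dual Q\<^esub> g) = r \<odot>\<^bsub>base_module\<^esub> bidual_eval Q (cls a) g" for r
  proof -
    have "r \<odot>\<^bsub>dual Q\<^esub> g \<in> carrier (dual Q)"
      using g by (rule dual_Q_smult_closed)
    thus ?thesis using g a by (simp add: bidual_eval_def base_module_def) (simp add: dual_Q_smult)
  qed
qed

private lemma Theta:
  "\<xi> \<in> carrier D \<Longrightarrow> \<Theta> \<xi> \<in> coord s"
  "\<xi> \<in> carrier D \<Longrightarrow> \<eta> \<in> carrier D \<Longrightarrow> \<Theta> (\<xi> \<oplus>\<^bsub>D\<^esub> \<eta>) = \<Theta> \<xi> + \<Theta> \<eta>"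
  "\<xi> \<in> carrier D \<Longrightarrow> \<Theta> (r \<odot>\<^bsub>D\<^esub> \<xi>) = (\<lambda>i. r * \<Theta> \<xi> i)"
  "inj_on \<Theta> (carrier D)" "\<Theta> ` carrier D = coord s"
  "\<Theta> ` gr D e = {v. (\<forall>i\<ge>s. v i = 0) \<and> (\<forall>i<s. form (e + int (\<sigma> i)) (v i))}"
  using iso by (auto simp: graded_iso_def linear_map_def free_module_def coord_def bij_betw_def)

lemma iota_coord: "a \<in> coord n \<Longrightarrow> iota a \<in> coord s"
  unfolding iota_def by (rule Theta(1)[OF eval_in_D])

lemma iota_add:
  assumes "a \<in> coord n" "b \<in> coord n" shows "iota (a + b) = iota a + iota b"
proof -
  have "bidual_eval Q (cls (a + b)) = bidual_eval Q (cls a) \<oplus>\<^bsub>D\<^esub> bidual_eval Q (cls b)"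
    unfolding add_D unfolding bidual_eval_def
    by (rule restrict_ext) (use assms in \<open>simp add: carrier_dual_Q\<close>)
  thus ?thesis unfolding iota_def by (simp add: Theta(2) eval_in_D assms)
qed

lemma iota_smult:
  assumes "a \<in> coord n" shows "iota (\<lambda>i. r * a i) = (\<lambda>i. r * iota a i)"
proof -
  have "bidual_eval Q (cls (\<lambda>i. r * a i)) = r \<odot>\<^bsub>D\<^esub> bidual_eval Q (cls a)"
    unfolding smult_D unfolding bidual_eval_def
    by (rule restrict_ext) (use assms in \<open>simp add: carrier_dual_Q\<close>)
  thus ?thesis unfolding iota_def by (simp add: Theta(3) eval_in_D assms)
qed

private lemma iota_0: "iota 0 = 0"
proof -
  have "(\<lambda>i. 0 * (0 :: nat \<Rightarrow> 'k bpoly) i) = 0" by (simp add: fun_eq_iff)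
  moreover have "(\<lambda>i. 0 * iota 0 i) = 0" by (simp add: fun_eq_iff)
  ultimately show ?thesis using iota_smult[of 0 0] by (simp only: coord_def mem_Collect_eq zero_fun_apply simp_thms)
qed

lemma iota_form:
  assumes "a \<in> coord n" "\<And>j. j < n \<Longrightarrow> form e (a j)" "i < s"
  shows "form (e + int (\<sigma> i)) (iota a i)"
proof -
  have "cls a \<in> gr Q e" using assms by (intro gr_Q)
  hence "form (e + e') (g (cls a))" if "g \<in> gr (dual Q) e'" for g e'
    using that by (simp add: dual_def)
  moreover have "gr (dual Q) e' \<subseteq> carrier (dual Q)" for e' by (auto simp: dual_def)
  ultimately have "bidual_eval Q (cls a) \<in> gr D e"
    using eval_in_D[OF assms(1)] unfolding carrier_D
    by (auto simp: dual_def[of "dual Q"] bidual_eval_def add.commute)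
  hence "iota a \<in> \<Theta> ` gr D e" unfolding iota_def by (rule imageI)
  thus ?thesis unfolding Theta(6) using assms(3) by simp
qed

lemma iota_relations:
  assumes "c \<in> coord m" shows "iota (mat_map n m \<phi> c) = 0"
proof -
  have "mat_map n m \<phi> c \<in> U" using assms by (simp add: U_def)
  hence "cls (mat_map n m \<phi> c) = cls 0" using cls_eq[of "mat_map n m \<phi> c" 0] by simp
  hence "iota (mat_map n m \<phi> c) = iota 0" by (simp add: iota_def)
  thus ?thesis by (simp add: iota_0)
qed

lemma image_iota: "(\<lambda>x. \<Theta> (bidual_eval Q x)) ` carrier Q = iota ` coord n"
  unfolding carrier_Q image_image iota_def ..

text \<open>Let \<open>\<psi>\<close> be a left inverse, up to the factor \<open>w\<close>, of the first \<open>m\<close> columns of \<open>\<phi>\<close>. The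
  matrix \<open>\<pi> = w - \<phi> \<psi>\<close> annihilates these columns, so its rows are functionals on \<open>E\<close>. Where all
  functionals vanish, \<open>\<pi>\<close> vanishes, so that \<open>w\<close> times the vector is \<open>\<phi> \<psi>\<close> of it. Moreover \<open>w g = \<Sum>\<^sub>k g(e\<^sub>k) \<pi>\<^sub>k\<close> for every functional \<open>g\<close>; applying \<open>\<xi>\<close> in
  the bidual shows that \<open>w \<xi>\<close> is the evaluation at the vector of the \<open>\<xi>(\<pi>\<^sub>k)\<close>. With \<open>w\<close> a power of a
  variable, this is the statement that \<open>E\<close> and its bidual agree away from the origin.\<close>

context
  fixes \<psi> :: "nat \<Rightarrow> nat \<Rightarrow> 'k bpoly" and w :: "'k bpoly"
  assumes split: "\<And>i i'. i < m \<Longrightarrow> i' < m \<Longrightarrow> (\<Sum>l<n. \<psi> i l * \<phi> l i') = (if i = i' then w else 0)"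
begin

private definition \<pi> :: "nat \<Rightarrow> nat \<Rightarrow> 'k bpoly" where
  "\<pi> k j = (if j = k then w else 0) - (\<Sum>i<m. \<phi> k i * \<psi> i j)"

private lemma \<pi>_relations:
  assumes "k < n" "i' < m" shows "(\<Sum>j<n. \<pi> k j * \<phi> j i') = 0"
proof -
  have "(\<Sum>j<n. \<pi> k j * \<phi> j i') = (\<Sum>j<n. (if j = k then w * \<phi> k i' else 0) - (\<Sum>i<m. \<phi> k i * (\<psi> i j * \<phi> j i')))"
    by (rule sum.cong) (auto simp: \<pi>_def left_diff_distrib sum_distrib_right mult.assoc)
  also have "\<dots> = w * \<phi> k i' - (\<Sum>j<n. \<Sum>i<m. \<phi> k i * (\<psi> i j * \<phi> j i'))"
    using assms by (simp add: sum_subtractf)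
  also have "(\<Sum>j<n. \<Sum>i<m. \<phi> k i * (\<psi> i j * \<phi> j i')) = (\<Sum>i<m. \<Sum>j<n. \<phi> k i * (\<psi> i j * \<phi> j i'))"
    by (rule sum.swap)
  also have "\<dots> = (\<Sum>i<m. if i = i' then \<phi> k i' * w else 0)"
    unfolding sum_distrib_left[symmetric] by (rule sum.cong) (use assms split in auto)
  also have "\<dots> = w * \<phi> k i'" using assms by (simp add: mult.commute)
  finally show ?thesis by simp
qed

private lemma \<pi>_apply:
  assumes "k < n"
  shows "(\<Sum>j<n. \<pi> k j * a j) = w * a k - mat_map n m \<phi> (\<lambda>i. if i < m then \<Sum>j<n. \<psi> i j * a j else 0) k"
proof -
  have "(\<Sum>j<n. \<pi> k j * a j) = (\<Sum>j<n. (if j = k then w * a k else 0) - (\<Sum>i<m. \<phi> k i * (\<psi> i j * a j)))"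
    by (rule sum.cong) (auto simp: \<pi>_def left_diff_distrib sum_distrib_right mult.assoc)
  also have "\<dots> = w * a k - (\<Sum>j<n. \<Sum>i<m. \<phi> k i * (\<psi> i j * a j))"
    using assms by (simp add: sum_subtractf)
  also have "(\<Sum>j<n. \<Sum>i<m. \<phi> k i * (\<psi> i j * a j)) = (\<Sum>i<m. \<Sum>j<n. \<phi> k i * (\<psi> i j * a j))"
    by (rule sum.swap)
  also have "\<dots> = mat_map n m \<phi> (\<lambda>i. if i < m then \<Sum>j<n. \<psi> i j * a j else 0) k"
    using assms by (simp add: mat_map_def sum_distrib_left)
  finally show ?thesis .
qed

lemma iota_kernel:
  assumes a: "a \<in> coord n" and "iota a = 0"
  shows "\<exists>c\<in>coord m. (\<lambda>j. w * a j) = mat_map n m \<phi> c"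
proof -
  have zero: "0 \<in> coord n" by (simp add: coord_def)
  have ev: "bidual_eval Q (cls a) = bidual_eval Q (cls 0)"
    using assms(2) iota_0 by (intro inj_onD[OF Theta(4)]) (simp_all add: iota_def eval_in_D a zero)
  hence eq: "g (cls a) = g (cls 0)" if "g \<in> carrier (dual Q)" for g
  proof -
    have "bidual_eval Q (cls a) g = bidual_eval Q (cls 0) g" by (simp only: ev)
    thus ?thesis using that by (simp only: bidual_eval_def restrict_apply')
  qed
  define c where "c = (\<lambda>i. if i < m then \<Sum>j<n. \<psi> i j * a j else 0)"
  have "w * a k = mat_map n m \<phi> c k" for k
  proof (cases "k < n")
    case k: True
    obtain g where g: "g \<in> carrier (dual Q)" "\<forall>a\<in>coord n. g (cls a) = (\<Sum>j<n. \<pi> k j * a j)"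
      using functional_of_covector[of "\<pi> k", OF \<pi>_relations[OF k]] ..
    have "(\<Sum>j<n. \<pi> k j * a j) = 0" using eq[OF g(1)] by (simp add: g(2)[rule_format] a zero)
    thus ?thesis using \<pi>_apply[OF k, of a] by (simp add: c_def)
  next
    case False
    thus ?thesis using a by (simp add: mat_map_def coord_def)
  qed
  thus ?thesis by (intro bexI[of _ c]) (auto simp: c_def coord_def)
qed

lemma iota_cokernel:
  assumes "v \<in> coord s"
  shows "\<exists>a\<in>coord n. iota a = (\<lambda>i. w * v i)"
proof -
  obtain \<xi> where \<xi>: "\<xi> \<in> carrier D" "v = \<Theta> \<xi>" using assms Theta(5) by blast
  have "\<forall>k. \<exists>g. k < n \<longrightarrow> g \<in> carrier (dual Q) \<and> (\<forall>a\<in>coord n. g (cls a) = (\<Sum>j<n. \<pi> k j * a j))"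
  proof (intro allI)
    fix k
    show "\<exists>g. k < n \<longrightarrow> g \<in> carrier (dual Q) \<and> (\<forall>a\<in>coord n. g (cls a) = (\<Sum>j<n. \<pi> k j * a j))"
    proof (cases "k < n")
      case True
      obtain g where "g \<in> carrier (dual Q)" "\<forall>a\<in>coord n. g (cls a) = (\<Sum>j<n. \<pi> k j * a j)"
        using functional_of_covector[of "\<pi> k", OF \<pi>_relations[OF True]] ..
      thus ?thesis by (intro exI[of _ g] impI conjI)
    qed simp
  qed
  from choice[OF this] obtain P where
    "\<forall>k. k < n \<longrightarrow> P k \<in> carrier (dual Q) \<and> (\<forall>a\<in>coord n. P k (cls a) = (\<Sum>j<n. \<pi> k j * a j))" ..
  hence P: "k < n \<Longrightarrow> P k \<in> carrier (dual Q)"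
    "k < n \<Longrightarrow> a \<in> coord n \<Longrightarrow> P k (cls a) = (\<Sum>j<n. \<pi> k j * a j)" for k a by simp_all
  define a where "a = (\<lambda>j. if j < n then \<xi> (P j) else 0)"
  have a: "a \<in> coord n" by (simp add: a_def coord_def)
  have "w * \<xi> g = g (cls a)" if g: "g \<in> carrier (dual Q)" for g
  proof -
    define \<gamma> where "\<gamma> k = g (cls (basis_vec k))" for k
    have g_cls: "g (cls b) = (\<Sum>k<n. \<gamma> k * b k)" if "b \<in> coord n" for b
      using functional_coord[OF g that] by (simp add: \<gamma>_def mult.commute)
    define S where "S = (\<lambda>x\<in>cls ` coord n. \<Sum>k<n. \<gamma> k * P k x)"
    have "S = w \<odot>\<^bsub>dual Q\<^esub> g" unfolding S_def dual_Q_smult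
    proof (rule restrict_ext, elim imageE)
      fix x b assume b: "b \<in> coord n" and x: "x = cls b"
      define c where "c = (\<lambda>i. if i < m then \<Sum>j<n. \<psi> i j * b j else 0)"
      have u: "mat_map n m \<phi> c \<in> U" "mat_map n m \<phi> c \<in> coord n"
        unfolding U_def by (auto simp: c_def coord_def mat_map_def intro!: imageI)
      have zero: "0 \<in> coord n" by (simp add: coord_def)
      have "(\<Sum>k<n. \<gamma> k * mat_map n m \<phi> c k) = g (cls (mat_map n m \<phi> c))" by (simp add: g_cls u)
      also have "\<dots> = g (cls 0)" using cls_eq[OF u(1), of 0] by simp
      also have "\<dots> = 0" by (simp add: g_cls zero)
      finally have *: "(\<Sum>k<n. \<gamma> k * mat_map n m \<phi> c k) = 0" .
      have "(\<Sum>k<n. \<gamma> k * P k x) = (\<Sum>k<n. \<gamma> k * (w * b k - mat_map n m \<phi> c k))"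
        by (rule sum.cong) (simp_all add: P(2) b x \<pi>_apply c_def)
      also have "\<dots> = w * (\<Sum>k<n. \<gamma> k * b k)"
        by (simp add: right_diff_distrib sum_subtractf * sum_distrib_left mult.left_commute)
      finally show "(\<Sum>k<n. \<gamma> k * P k x) = w * g x" by (simp add: x g_cls b)
    qed
    hence "w * \<xi> g = \<xi> S" using \<xi>(1) g by (simp add: carrier_D linear_map_def base_module_def)
    also have "\<dots> = (\<Sum>k<n. \<gamma> k * \<xi> (P k))"
      unfolding S_def using dual_Q_sum[OF P(1) g \<xi>(1), where \<gamma> = \<gamma>] by simp
    also have "\<dots> = g (cls a)" unfolding g_cls[OF a] by (rule sum.cong) (simp_all add: a_def)
    finally show ?thesis .
  qed
  hence "bidual_eval Q (cls a) = w \<odot>\<^bsub>D\<^esub> \<xi>"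
    unfolding smult_D bidual_eval_def by (intro restrict_ext) simp
  hence "iota a = (\<lambda>i. w * v i)" unfolding iota_def \<xi>(2) by (simp add: Theta(3) \<xi>(1))
  thus ?thesis using a by blast
qed

end

end

section \<open>Elements of high degree\<close>

text \<open>A homogeneous map of degree 0 from \<open>R\<^sup>n\<close> to \<open>\<Oplus>\<^sub>i R(\<sigma>\<^sub>i)\<close>.\<close>

locale graded_free_map =
  fixes n s :: nat and \<sigma> :: "nat \<Rightarrow> nat"
    and iota :: "(nat \<Rightarrow> 'k::field bpoly) \<Rightarrow> nat \<Rightarrow> 'k bpoly"
  assumes coord: "a \<in> coord n \<Longrightarrow> iota a \<in> coord s"
    and add: "a \<in> coord n \<Longrightarrow> b \<in> coord n \<Longrightarrow> iota (a + b) = iota a + iota b"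
    and smult: "a \<in> coord n \<Longrightarrow> iota (\<lambda>i. r * a i) = (\<lambda>i. r * iota a i)"
    and graded: "a \<in> coord n \<Longrightarrow> (\<And>j. j < n \<Longrightarrow> form e (a j)) \<Longrightarrow> i < s \<Longrightarrow> form (e + int (\<sigma> i)) (iota a i)"
begin

lemma form_iota_unit: "j < n \<Longrightarrow> i < s \<Longrightarrow> form (int (\<sigma> i)) (iota (basis_vec j) i)"
proof -
  assume "j < n" "i < s"
  hence "form (0 + int (\<sigma> i)) (iota (basis_vec j) i)"
    by (intro graded) (simp_all add: coord_def form_iff_xdeg)
  thus ?thesis by simp
qed

lemma iota_expand:
  assumes "a \<in> coord n" shows "iota a i = (\<Sum>j<n. a j * iota (basis_vec j) i)"
  using assms by (intro linear_on_coord[where h = "\<lambda>a. iota a i"]) (simp_all add: add smult)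

lemma homogeneous_preimage:
  assumes a: "a \<in> coord n" and v: "\<And>i. i < s \<Longrightarrow> form (e + int (\<sigma> i)) (iota a i)"
  obtains a' where "a' \<in> coord n" "\<And>j. j < n \<Longrightarrow> form e (a' j)" "iota a' = iota a"
proof (rule that)
  define a' where "a' = (\<lambda>j. form_component e (a j))"
  show a': "a' \<in> coord n" using a by (simp add: a'_def coord_def)
  show "form e (a' j)" for j by (simp add: a'_def)
  show "iota a' = iota a"
  proof
    fix i
    show "iota a' i = iota a i"
    proof (cases "i < s")
      case i: True
      have "iota a i = form_component (int (\<sigma> i) + e) (iota a i)"
        using v[OF i] by (simp add: form_component_form add.commute)
      also have "\<dots> = (\<Sum>j<n. form_component (int (\<sigma> i) + e) (iota (basis_vec j) i * a j))"
        unfolding iota_expand[OF a, of i] form_component_sum by (simp add: mult.commute)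
      also have "\<dots> = (\<Sum>j<n. iota (basis_vec j) i * a' j)"
        by (rule sum.cong) (simp_all add: form_component_mult[OF form_iota_unit[OF _ i]] a'_def)
      finally show ?thesis using iota_expand[OF a', of i] by (simp add: mult.commute)
    next
      case False
      thus ?thesis using coord[OF a] coord[OF a'] by (simp add: coord_def)
    qed
  qed
qed

text \<open>A Cech argument. The two multiples \<open>x\<^sub>0\<^sup>N u\<close> and \<open>x\<^sub>1\<^sup>N u\<close> lift to forms \<open>a0\<close> and \<open>a1\<close>. The obstruction to gluing
  \<open>a0 / x\<^sub>0\<^sup>N\<close> and \<open>a1 / x\<^sub>1\<^sup>N\<close> to a lift of \<open>u\<close> is a relation with coefficients \<open>c'\<close>. Their degree is large enough
  for \<open>c'\<close> to be a sum of multiples of powers of \<open>x\<^sub>0\<close> and of \<open>x\<^sub>1\<close>, and such a relation can be removed by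
  changing both lifts by relations.\<close>

lemma high_degree_in_image:
  fixes \<delta> :: "nat \<Rightarrow> nat" and \<phi> :: "nat \<Rightarrow> nat \<Rightarrow> 'k bpoly" and N K m :: nat
  assumes relations: "\<And>c. c \<in> coord m \<Longrightarrow> iota (mat_map n m \<phi> c) = 0"
    and kernel: "\<And>b a. a \<in> coord n \<Longrightarrow> iota a = 0 \<Longrightarrow> \<exists>c\<in>coord m. (\<lambda>j. xpow b N * a j) = mat_map n m \<phi> c"
    and cokernel: "\<And>b v. v \<in> coord s \<Longrightarrow> \<exists>a\<in>coord n. iota a = (\<lambda>i. xpow b N * v i)"
    and \<phi>: "\<And>j i. j < n \<Longrightarrow> i < m \<Longrightarrow> form (int (\<delta> i)) (\<phi> j i)"
    and \<delta>: "\<And>i. i < m \<Longrightarrow> \<delta> i \<le> K + 1"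
    and u: "u \<in> coord s" "\<And>i. i < s \<Longrightarrow> form (int K + int (\<sigma> i)) (u i)"
  shows "\<exists>r\<in>coord n. (\<forall>j<n. form (int K) (r j)) \<and> iota r = u"
proof -
  \<comment> \<open>The difference of the lifts on the overlap is a relation only after multiplication by
    another \<open>x\<^sub>0\<^sup>N\<close>; doubling the exponents of the denominators accounts for this.\<close>
  define L where "L = N + N"
  have diff: "iota (a - b) = iota a - iota b" if "a \<in> coord n" "b \<in> coord n" for a b
  proof -
    have "a - b \<in> coord n" using that by (simp add: coord_def)
    from add[OF this that(2)] show ?thesis by (simp add: algebra_simps)
  qed
  have pre: "\<exists>a. a \<in> coord n \<and> (\<forall>j<n. form (int K + int N) (a j)) \<and> iota a = (\<lambda>i. xpow b N * u i)" for b
  proof -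
    obtain a where a: "a \<in> coord n" "iota a = (\<lambda>i. xpow b N * u i)" using cokernel[OF u(1)] by blast
    have "form (int K + int N + int (\<sigma> i)) (iota a i)" if "i < s" for i
      unfolding a(2) using form_mult[OF form_xpow u(2)[OF that], of N b] by (simp add: ac_simps)
    then obtain a' where "a' \<in> coord n" "\<And>j. j < n \<Longrightarrow> form (int K + int N) (a' j)" "iota a' = iota a"
      using homogeneous_preimage[OF a(1)] by blast
    thus ?thesis using a(2) by (intro exI[of _ a']) simp
  qed
  obtain a0 where a0: "a0 \<in> coord n" "\<forall>j<n. form (int K + int N) (a0 j)" "iota a0 = (\<lambda>i. xpow False N * u i)"
    using pre by blast
  obtain a1 where a1: "a1 \<in> coord n" "\<forall>j<n. form (int K + int N) (a1 j)" "iota a1 = (\<lambda>i. xpow True N * u i)"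
    using pre by blast
  have mult_coord: "(\<lambda>j. r * a j) \<in> coord n" if "a \<in> coord n" for a and r :: "'k bpoly"
    using that by (simp add: coord_def)
  define y where "y = (\<lambda>j. xpow True N * a0 j) - (\<lambda>j. xpow False N * a1 j)"
  have "y \<in> coord n" using a0(1) a1(1) by (simp add: y_def coord_def)
  moreover have "iota y = 0"
    unfolding y_def using a0 a1 by (simp add: diff mult_coord smult fun_eq_iff mult.left_commute)
  ultimately obtain c where c: "c \<in> coord m" "(\<lambda>j. xpow False N * y j) = mat_map n m \<phi> c"
    using kernel by blast
  define D where "D = int K + 2 * int L"
  \<comment> \<open>Both sides of the relation are forms of degree \<open>D\<close>, so the coefficients may be replaced by
    their components of degree \<open>D - \<delta> i \<ge> 2 L - 1\<close>.\<close>
  define c' where "c' = (\<lambda>i. form_component (D - int (\<delta> i)) (xpow True N * c i))"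
  have c'_eq: "mat_map n m \<phi> c' j = xpow True L * (xpow False N * a0 j) - xpow False L * (xpow True N * a1 j)"
    if j: "j < n" for j
  proof -
    have form_b: "form D (xpow b L * (xpow b' N * a j))" if "form (int K + int N) (a j)" for a b b'
    proof -
      have "form (int L + (int N + (int K + int N))) (xpow b L * (xpow b' N * a j))"
        by (intro form_mult form_xpow that)
      moreover have "int L + (int N + (int K + int N)) = D" by (simp add: D_def L_def)
      ultimately show ?thesis by simp
    qed
    have component_\<phi>: "form_component D (\<phi> j i * r) = \<phi> j i * form_component (D - int (\<delta> i)) r" if "i < m" for i r
      using form_component_mult[OF \<phi>[OF j that], of "D - int (\<delta> i)" r] by simp
    have "mat_map n m \<phi> c' j = (\<Sum>i<m. form_component D (\<phi> j i * (xpow True N * c i)))"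
      unfolding mat_map_def c'_def using j component_\<phi> by simp
    also have "\<dots> = form_component D (xpow True N * mat_map n m \<phi> c j)"
      using j by (simp add: mat_map_def form_component_sum sum_distrib_left mult.left_commute)
    also have "xpow True N * mat_map n m \<phi> c j
        = xpow True L * (xpow False N * a0 j) - xpow False L * (xpow True N * a1 j)"
      unfolding c(2)[symmetric] by (simp add: y_def L_def xpow_add algebra_simps)
    also have "form_component D \<dots> = \<dots>"
      using j a0(2) a1(2) by (intro form_component_form form_diff form_b) auto
    finally show ?thesis .
  qed
  have "\<exists>p q. c' i = xpow False L * p + xpow True L * q" if "i < m" for i
  proof (rule high_degree_split)
    fix \<tau> assume "\<tau> \<in> keys (c' i)"
    hence "int (xdeg \<tau>) = D - int (\<delta> i)" using form_of_component unfolding c'_def form_iff_xdeg by blast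
    thus "2 * L \<le> xdeg \<tau> + 1" using \<delta>[OF that] by (simp add: D_def)
  qed
  hence "\<forall>i. \<exists>pq. i < m \<longrightarrow> c' i = xpow False L * fst pq + xpow True L * snd pq" by auto
  from choice[OF this] obtain pq
    where pq: "\<forall>i. i < m \<longrightarrow> c' i = xpow False L * fst (pq i) + xpow True L * snd (pq i)" ..
  define p q where "p = (\<lambda>i. if i < m then fst (pq i) else 0)" and "q = (\<lambda>i. if i < m then snd (pq i) else 0)"
  have "mat_map n m \<phi> c' = mat_map n m \<phi> ((\<lambda>i. xpow False L * p i) + (\<lambda>i. xpow True L * q i))"
    by (auto simp: mat_map_def fun_eq_iff p_def q_def pq intro!: sum.cong)
  hence c'_split: "mat_map n m \<phi> c' j = xpow False L * mat_map n m \<phi> p j + xpow True L * mat_map n m \<phi> q j" for j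
    by (simp add: mat_map_add mat_map_smult)
  \<comment> \<open>The numerator over \<open>x\<^sub>0\<^sup>L\<close> of the corrected lift; comparison with the one over \<open>x\<^sub>1\<^sup>L\<close> shows that it is
    divisible by \<open>x\<^sub>0\<^sup>L\<close>.\<close>
  define z where "z = (\<lambda>j. xpow False N * a0 j) - mat_map n m \<phi> q"
  have q: "q \<in> coord m" "mat_map n m \<phi> q \<in> coord n" by (simp_all add: q_def coord_def mat_map_def)
  have "\<exists>e. z j = xpow False L * e" if j: "j < n" for j
  proof (rule xpow_dvd_if_mult_eq[of False True])
    show "xpow True L * z j = xpow False L * (xpow True N * a1 j + mat_map n m \<phi> p j)"
      using c'_eq[OF j] unfolding c'_split by (simp add: z_def algebra_simps)
  qed simp
  hence "\<forall>j. \<exists>e. j < n \<longrightarrow> z j = xpow False L * e" by blast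
  from choice[OF this] obtain e where e: "\<forall>j. j < n \<longrightarrow> z j = xpow False L * e j" ..
  define e' where "e' = (\<lambda>j. if j < n then e j else 0)"
  have e': "e' \<in> coord n" by (simp add: e'_def coord_def)
  have "z = (\<lambda>j. xpow False L * e' j)"
    using e a0(1) q(2) by (auto simp: fun_eq_iff e'_def z_def coord_def)
  hence "(\<lambda>i. xpow False L * iota e' i) = iota z" by (simp add: smult e')
  also have "\<dots> = (\<lambda>i. xpow False L * u i)"
    unfolding z_def using a0 q
    by (simp add: diff mult_coord relations smult L_def xpow_add mult.assoc fun_eq_iff)
  finally have "iota e' = u" by (auto simp: fun_eq_iff)
  with homogeneous_preimage[OF e', of "int K"] u(2) show ?thesis by blast
qed

end

section \<open>Integral closure and reduction\<close>

theorem theorem2p9: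
  fixes f :: "nat \<Rightarrow> 'k::field bpoly"
    and I :: "'k bpoly set"
    and n d m s :: nat
    and \<delta> \<sigma> :: "nat \<Rightarrow> nat"
    and \<phi> :: "nat \<Rightarrow> nat \<Rightarrow> 'k bpoly"
    and \<Theta> :: "(((nat \<Rightarrow> 'k bpoly) set \<Rightarrow> 'k bpoly) \<Rightarrow> 'k bpoly) \<Rightarrow> nat \<Rightarrow> 'k bpoly"
    and E M :: "(nat \<Rightarrow> 'k bpoly) set"
  assumes forms: "\<And>j. j < n \<Longrightarrow> form (int d) (f j)"
    and generators: "minimally_generates (ring_of_type_algebra :: 'k bpoly ring) n f I"
    and height: "ideal_height (ring_of_type_algebra :: 'k bpoly ring) I = 2"
    and resolution: "hilbert_burch_resolution n f \<delta> \<phi>"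
    and degrees_pos: "\<And>i. i < n - 1 \<Longrightarrow> 1 \<le> \<delta> i"
    and degrees_mono: "mono_on {..<n - 1} \<delta>"
    and m: "1 \<le> m" "m \<le> n - 1"
    and s: "s = n - m"
    and iso: "graded_iso (dual (dual (E_module n m \<phi>))) (free_module s (\<lambda>i. int (\<sigma> i))) \<Theta>"
    and shifts: "antimono_on {..<s} \<sigma>"
    and E: "E = (\<lambda>x. \<Theta> (bidual_eval (E_module n m \<phi>) x)) ` carrier (E_module n m \<phi>)"
    and M: "M = sum_of_pieces {0..} (gr (free_module s (\<lambda>i. int (\<sigma> i))))"
  shows "(bitruncation \<sigma> (int (\<delta> (m - 1)) - 1) (Rees s E)
            = bitruncation \<sigma> (int (\<delta> (m - 1)) - 1) (Rees s M)
          \<and> bitruncation \<sigma> (int (\<delta> (m - 1)) - 1) (Rees s M)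
            = bitruncation \<sigma> (int (\<delta> (m - 1)) - 1) (Rees_free s))
       \<and> to_fract ` Rees s M
            = integral_closure_in (to_fract ` Rees s E) (frac_field (Rees s E))
       \<and> is_reduction_in_free s E M"
proof -
  let ?Q = "E_module n m \<phi>"
  \<comment> \<open>Columns are counted from 0, so \<open>\<delta> (m - 1)\<close> is the largest degree among the first \<open>m\<close> columns.\<close>
  define K where "K = \<delta> (m - 1) - 1"
  have K: "int (\<delta> (m - 1)) - 1 = int K" using degrees_pos[of "m - 1"] m by (simp add: K_def of_nat_diff)
  have \<delta>: "\<delta> i \<le> K + 1" if "i < m" for i
  proof -
    have "\<delta> i \<le> \<delta> (m - 1)" using m that by (intro mono_onD[OF degrees_mono]) auto
    thus ?thesis by (simp add: K_def)
  qed
  have \<phi>: "form (int (\<delta> i)) (\<phi> j i)" if "j < n" "i < m" for i j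
    using resolution that m by (simp add: hilbert_burch_resolution_def Let_def)
  \<comment> \<open>If all \<open>f j\<close> were 0, the generator \<open>f 0\<close> could be dropped, as \<open>n \<ge> 2\<close>.\<close>
  have nz: "\<exists>j<n. f j \<noteq> 0"
  proof (rule ccontr)
    assume "\<not> ?thesis"
    moreover have "0 \<in> {..<n}" "1 \<in> {..<n} - {0}" using m by auto
    ultimately have "f ` {..<n} = {0}" "f ` ({..<n} - {0}) = {0}" by auto
    hence "f ` {..<n} = f ` ({..<n} - {0})" by simp
    moreover have "0 < n" using m by simp
    ultimately show False using generators unfolding minimally_generates_def by auto
  qed
  define \<iota> where "\<iota> = iota n m \<phi> \<Theta>"
  interpret graded_free_map n s \<sigma> \<iota>
    unfolding \<iota>_def
    by unfold_locales (fact iota_coord[OF iso] iota_add[OF iso] iota_smult[OF iso] iota_form[OF iso])+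
  have E_eq: "E = \<iota> ` coord n" unfolding E \<iota>_def by (rule image_iota[OF iso])
  have "\<exists>N. \<exists>\<psi>. \<forall>i<n - 1. \<forall>i'<n - 1. (\<Sum>l<n. \<psi> i l * \<phi> l i') = (if i = i' then xpow b N else 0)" for b
    by (rule hilbert_burch_local_splitting[OF forms nz resolution])
  hence "\<forall>b. \<exists>N. \<exists>\<psi>. \<forall>i<n - 1. \<forall>i'<n - 1. (\<Sum>l<n. \<psi> i l * \<phi> l i') = (if i = i' then xpow b N else 0)" ..
  from choice[OF this] obtain Nf where Nf: "\<forall>b. \<exists>\<psi>. \<forall>i<n - 1. \<forall>i'<n - 1.
      (\<Sum>l<n. \<psi> i l * \<phi> l i') = (if i = i' then xpow b (Nf b) else 0)" ..
  \<comment> \<open>A common exponent for the two variables.\<close>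
  define N where "N = Nf False + Nf True"
  have split: "\<exists>\<psi>. \<forall>i<m. \<forall>i'<m. (\<Sum>l<n. \<psi> i l * \<phi> l i') = (if i = i' then xpow b N else 0)" for b
  proof -
    obtain \<psi> where \<psi>: "\<forall>i<n - 1. \<forall>i'<n - 1. (\<Sum>l<n. \<psi> i l * \<phi> l i') = (if i = i' then xpow b (Nf b) else 0)"
      using Nf by blast
    have "Nf b \<le> N" by (cases b) (simp_all add: N_def)
    hence "xpow b (N - Nf b) * xpow b (Nf b) = (xpow b N :: 'k bpoly)" by (simp flip: xpow_add)
    moreover have "(\<Sum>l<n. xpow b (N - Nf b) * \<psi> i l * \<phi> l i') = xpow b (N - Nf b) * (\<Sum>l<n. \<psi> i l * \<phi> l i')" for i i'
      by (simp add: sum_distrib_left mult.assoc)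
    ultimately show ?thesis using \<psi> m
      by (intro exI[of _ "\<lambda>i l. xpow b (N - Nf b) * \<psi> i l"]) auto
  qed
  have kernel: "\<exists>c\<in>coord m. (\<lambda>j. xpow b N * a j) = mat_map n m \<phi> c"
    if "a \<in> coord n" "\<iota> a = 0" for a b
  proof -
    obtain \<psi> where \<psi>: "\<forall>i<m. \<forall>i'<m. (\<Sum>l<n. \<psi> i l * \<phi> l i') = (if i = i' then xpow b N else 0)"
      using split by blast
    show ?thesis using that unfolding \<iota>_def by (intro iota_kernel[OF iso \<psi>[rule_format]])
  qed
  have cokernel: "\<exists>a\<in>coord n. \<iota> a = (\<lambda>i. xpow b N * v i)" if "v \<in> coord s" for v b
  proof -
    obtain \<psi> where \<psi>: "\<forall>i<m. \<forall>i'<m. (\<Sum>l<n. \<psi> i l * \<phi> l i') = (if i = i' then xpow b N else 0)"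
      using split by blast
    show ?thesis using that unfolding \<iota>_def by (intro iota_cokernel[OF iso \<psi>[rule_format]])
  qed
  have relations: "\<iota> (mat_map n m \<phi> c) = 0" if "c \<in> coord m" for c
    unfolding \<iota>_def using that by (rule iota_relations[OF iso])
  show ?thesis unfolding K
  proof (rule Rees_comparison[OF M, where n = n and \<epsilon> = "\<lambda>j. \<iota> (basis_vec j)"])
    show "\<sigma> i \<le> xdeg \<tau>" if v: "v \<in> E" and i: "i < s" and \<tau>: "\<tau> \<in> keys (v i)" for v i \<tau>
    proof -
      obtain a where a: "a \<in> coord n" "v = \<iota> a" using v E_eq by blast
      obtain j where j: "j < n" "\<tau> \<in> keys (a j * \<iota> (basis_vec j) i)"
        using \<tau> keys_sum[of "\<lambda>j. a j * \<iota> (basis_vec j) i" "{..<n}"] unfolding a(2) iota_expand[OF a(1), of i] by blast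
      then obtain t u where "u \<in> keys (\<iota> (basis_vec j) i)" "\<tau> = t + u"
        using keys_mult[of "a j" "\<iota> (basis_vec j) i"] by blast
      thus ?thesis using form_iota_unit[OF j(1) i] by (simp add: form_iff_xdeg)
    qed
    show "\<iota> (basis_vec j) \<in> E" if "j < n" for j
      unfolding E_eq using that by (intro imageI) (simp add: coord_def)
    fix i \<tau> assume i: "i < s" and \<tau>: "xdeg \<tau> = K + \<sigma> i"
    define u :: "nat \<Rightarrow> 'k bpoly" where "u = (\<lambda>l. if l = i then single \<tau> 1 else 0)"
    have "u \<in> coord s" using i by (simp add: u_def coord_def)
    moreover have "form (int K + int (\<sigma> l)) (u l)" for l using \<tau> by (simp add: u_def form_iff_xdeg)
    ultimately obtain r where r: "r \<in> coord n" "\<forall>j<n. form (int K) (r j)" "\<iota> r = u"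
      using high_degree_in_image[OF relations kernel cokernel \<phi> \<delta>, of u] by blast
    have "u = (\<lambda>l. \<Sum>j<n. r j * \<iota> (basis_vec j) l)"
      using iota_expand[OF r(1)] r(3) by auto
    hence "lin s u = (\<Sum>j<n. single 0 (r j) * lin s (\<iota> (basis_vec j)))" by (simp add: lin_sum)
    moreover have "lin s u = mono_xw 1 \<tau> (single i 1)" unfolding u_def by (rule lin_unit[OF i])
    ultimately show "\<exists>r. (\<forall>j<n. form (int K) (r j)) \<and>
        mono_xw 1 \<tau> (single i 1) = (\<Sum>j<n. single 0 (r j) * lin s (\<iota> (basis_vec j)))"
      using r(2) by (intro exI[of _ r]) simp
  qed
qed

end
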